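(* Let $B=(B_t;0\le t\le 1)$ be standard Brownian motion started at $0$. Then its Vervaat transform $(V(B)_t; 0 \leq t \leq 1)$ is not a Markov process.
   Context: For a continuous $f:[0,1]\to\mathbb{R}$ with $f(0)=0$, let $\tau(f)$ be the first time at which the minimum of $f$ on $[0,1]$ is attained. The Vervaat transform of $f$ is $V(f)(t):=f(\tau(f)+t \bmod 1)+f(1)1_{\{t+\tau(f) \geq 1\}}-f(\tau(f))$, $t\in[0,1]$. Markov processes are not assumed to be time-homogeneous, and the Markov property is understood with respect to the filtration induced by the process. *)

theory Defs
  imports "HOL-Probability.Probability"
begin

definition first_argmin :: "(real \<Rightarrow> real) \<Rightarrow> real" where
  "first_argmin f = (LEAST t. t \<in> {0..1} \<and> (\<forall>s\<in>{0..1}. f t \<le> f s))"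

definition vervaat :: "(real \<Rightarrow> real) \<Rightarrow> real \<Rightarrow> real" where
  "vervaat f t =
     f (frac (first_argmin f + t)) + f 1 * indicator {u. u \<ge> 1} (t + first_argmin f)
       - f (first_argmin f)"

(* Every path, not just almost every path, is continuous and starts at 0, since the Vervaat
   transform is only defined for such functions. *)

locale standard_brownian_motion = prob_space M
  for M :: "'a measure" and B :: "real \<Rightarrow> 'a \<Rightarrow> real" +
  assumes random_variable_B: "\<And>t. t \<in> {0..1} \<Longrightarrow> random_variable borel (B t)"
    and start_zero: "\<And>\<omega>. \<omega> \<in> space M \<Longrightarrow> B 0 \<omega> = 0"
    and continuous_paths: "\<And>\<omega>. \<omega> \<in> space M \<Longrightarrow> continuous_on {0..1} (\<lambda>t. B t \<omega>)"
    and normal_increments: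
      "\<And>s t. 0 \<le> s \<Longrightarrow> s < t \<Longrightarrow> t \<le> 1 \<Longrightarrow>
         distributed M lborel (\<lambda>\<omega>. B t \<omega> - B s \<omega>) (normal_density 0 (sqrt (t - s)))"
    and independent_increments:
      "\<And>(n::nat) (t :: nat \<Rightarrow> real). strict_mono_on {..n} t \<Longrightarrow> t ` {..n} \<subseteq> {0..1} \<Longrightarrow>
         indep_vars (\<lambda>_. borel) (\<lambda>i \<omega>. B (t (Suc i)) \<omega> - B (t i) \<omega>) {..<n}"

definition natural_filtration ::
    "'a measure \<Rightarrow> real set \<Rightarrow> (real \<Rightarrow> 'a \<Rightarrow> real) \<Rightarrow> real \<Rightarrow> 'a measure" where
  "natural_filtration M T X s =
     sigma (space M) {X u -` A \<inter> space M | u A. u \<in> T \<and> u \<le> s \<and> A \<in> sets borel}"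

(* P(X t : A | F s) = P(X t : A | X s) almost surely, where F is the filtration generated by X. *)

definition markov_process ::
    "'a measure \<Rightarrow> real set \<Rightarrow> (real \<Rightarrow> 'a \<Rightarrow> real) \<Rightarrow> bool" where
  "markov_process M T X \<longleftrightarrow>
     (\<forall>t\<in>T. X t \<in> borel_measurable M) \<and>
     (\<forall>s\<in>T. \<forall>t\<in>T. s \<le> t \<longrightarrow> (\<forall>A\<in>sets borel.
        AE \<omega> in M.
          real_cond_exp M (natural_filtration M T X s) (\<lambda>\<omega>. indicator A (X t \<omega>)) \<omega>
          = real_cond_exp M (vimage_algebra (space M) (X s) borel) (\<lambda>\<omega>. indicator A (X t \<omega>)) \<omega>))"

(* The measurability clause of markov_process is satisfied by the Vervaat transform of Brownian
   motion (lemma measurable_vervaat below), so its negation there concerns the conditional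
   probabilities. *)

lemma first_argmin:
  assumes f: "continuous_on {0..1} f"
  shows "first_argmin f \<in> {0..1}" "s \<in> {0..1} \<Longrightarrow> f (first_argmin f) \<le> f s"
    and "u \<in> {0..1} \<Longrightarrow> (\<And>s. s \<in> {0..1} \<Longrightarrow> f u \<le> f s) \<Longrightarrow> first_argmin f \<le> u"
proof -
  obtain x where x: "x \<in> {0..1}" "\<And>s. s \<in> {0..1} \<Longrightarrow> f x \<le> f s"
    using continuous_attains_inf[OF _ _ f] by (auto simp: Bex_def)
  define K where "K = {t \<in> {0..1}. f t \<in> {..f x}}"
  have K: "K = {t. t \<in> {0..1} \<and> (\<forall>s\<in>{0..1}. f t \<le> f s)}"
    unfolding K_def using x by (auto intro: order_trans)
  have "closed K"
    unfolding K_def using continuous_closed_preimage[OF f, of "{..f x}"]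
    by (simp add: vimage_def Int_def conj_commute)
  moreover have "bounded K"
    unfolding K_def by (rule bounded_subset[of "{0..1}"]) auto
  ultimately have "compact K" by (simp add: compact_eq_bounded_closed)
  moreover have "K \<noteq> {}" using x by (auto simp: K_def)
  ultimately obtain m where m: "m \<in> K" "\<And>t. t \<in> K \<Longrightarrow> m \<le> t"
    using compact_attains_inf[of K] by auto
  have "first_argmin f = m"
    unfolding first_argmin_def using m unfolding K by (intro Least_equality) auto
  with m show "first_argmin f \<in> {0..1}" "s \<in> {0..1} \<Longrightarrow> f (first_argmin f) \<le> f s"
    "u \<in> {0..1} \<Longrightarrow> (\<And>s. s \<in> {0..1} \<Longrightarrow> f u \<le> f s) \<Longrightarrow> first_argmin f \<le> u"
    unfolding K by auto
qed

lemma rational_approx: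
  fixes f :: "real \<Rightarrow> real"
  assumes f: "continuous_on {0..1} f" and x: "x \<in> {0..s}" and s: "s \<in> {0..1}" and e: "e > 0"
  shows "\<exists>p\<in>\<rat> \<inter> {0..s}. f p < f x + e"
proof (cases "x = 0")
  case True
  with x e show ?thesis by (intro bexI[of _ 0]) auto
next
  case False
  obtain d where d: "d > 0" "\<And>y. y \<in> {0..1} \<Longrightarrow> dist y x < d \<Longrightarrow> dist (f y) (f x) < e"
    using f[unfolded continuous_on_iff, rule_format, of x e] x s e by auto
  obtain q where q: "q \<in> \<rat>" "max 0 (x - d) < q" "q < x"
    using Rats_dense_in_real[of "max 0 (x - d)" x] False x d by auto
  have "dist (f q) (f x) < e"
    using q x s by (intro d) (auto simp: dist_real_def)
  with q x show ?thesis by (intro bexI[of _ q]) (auto simp: dist_real_def)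
qed

lemma first_argmin_le_iff:
  assumes f: "continuous_on {0..1} f" and s: "s \<in> {0..1}"
  shows "first_argmin f \<le> s \<longleftrightarrow>
    (\<forall>q\<in>\<rat> \<inter> {0..1}. \<forall>n::nat. \<exists>p\<in>\<rat> \<inter> {0..s}. f p < f q + 1 / Suc n)" (is "_ \<longleftrightarrow> ?R")
proof
  assume le: "first_argmin f \<le> s"
  show ?R
  proof safe
    fix q :: real and n :: nat assume q: "q \<in> {0..1}"
    have "\<exists>p\<in>\<rat> \<inter> {0..s}. f p < f (first_argmin f) + 1 / Suc n"
      using first_argmin(1)[OF f] le by (intro rational_approx[OF f _ s]) auto
    with first_argmin(2)[OF f q] show "\<exists>p\<in>\<rat> \<inter> {0..s}. f p < f q + 1 / Suc n" by force
  qed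
next
  assume R: ?R
  have "continuous_on {0..s} f" using f s by (auto intro: continuous_on_subset)
  then obtain u where u: "u \<in> {0..s}" "\<And>p. p \<in> {0..s} \<Longrightarrow> f u \<le> f p"
    using continuous_attains_inf[of "{0..s}" f] s by (auto simp: Bex_def)
  have "f u \<le> f v" if v: "v \<in> {0..1}" for v
  proof (rule field_le_epsilon)
    fix e :: real assume e: "e > 0"
    obtain q where q: "q \<in> \<rat> \<inter> {0..1}" "f q < f v + e / 2"
      using rational_approx[OF f v, of "e / 2"] e by auto
    obtain n where n: "1 / real (Suc n) < e / 2" using nat_approx_posE[of "e / 2"] e by auto
    obtain p where p: "p \<in> {0..s}" "f p < f q + 1 / Suc n" using R q by blast
    show "f u \<le> f v + e" using u(2)[OF p(1)] p(2) q n by linarith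
  qed
  then have "first_argmin f \<le> u" using u s by (intro first_argmin(3)[OF f]) auto
  then show "first_argmin f \<le> s" using u by auto
qed

lemma measurable_at_random_time:
  fixes X :: "real \<Rightarrow> 'a \<Rightarrow> real"
  assumes X: "\<And>t. t \<in> {0..1} \<Longrightarrow> X t \<in> borel_measurable M"
    and c: "\<And>\<omega>. \<omega> \<in> space M \<Longrightarrow> continuous_on {0..1} (\<lambda>t. X t \<omega>)"
    and \<sigma>[measurable]: "\<sigma> \<in> borel_measurable M"
    and \<sigma>_range: "\<And>\<omega>. \<omega> \<in> space M \<Longrightarrow> \<sigma> \<omega> \<in> {0..1}"
  shows "(\<lambda>\<omega>. X (\<sigma> \<omega>) \<omega>) \<in> borel_measurable M"
proof (rule borel_measurable_LIMSEQ_real)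
  define r where "r n \<omega> = real_of_int \<lfloor>Suc n * \<sigma> \<omega>\<rfloor> / Suc n" for n :: nat and \<omega>
  have r_bounds: "r n \<omega> \<in> {0..1}" "\<bar>r n \<omega> - \<sigma> \<omega>\<bar> \<le> 1 / Suc n" if "\<omega> \<in> space M" for n \<omega>
  proof -
    have *: "0 \<le> Suc n * \<sigma> \<omega>" "Suc n * \<sigma> \<omega> \<le> Suc n" using \<sigma>_range[OF that] by (auto simp: mult_le_cancel_left1)
    then have "0 \<le> \<lfloor>Suc n * \<sigma> \<omega>\<rfloor>" by simp
    moreover have "real_of_int \<lfloor>Suc n * \<sigma> \<omega>\<rfloor> \<le> Suc n" using * by linarith
    ultimately show "r n \<omega> \<in> {0..1}" by (simp add: r_def)
    have "r n \<omega> - \<sigma> \<omega> = (real_of_int \<lfloor>Suc n * \<sigma> \<omega>\<rfloor> - Suc n * \<sigma> \<omega>) / Suc n"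
      by (simp add: r_def field_simps)
    moreover have "\<bar>real_of_int \<lfloor>Suc n * \<sigma> \<omega>\<rfloor> - Suc n * \<sigma> \<omega>\<bar> \<le> 1" by linarith
    ultimately show "\<bar>r n \<omega> - \<sigma> \<omega>\<bar> \<le> 1 / Suc n" by (simp add: abs_divide divide_right_mono)
  qed
  show "(\<lambda>n. X (r n \<omega>) \<omega>) \<longlonglongrightarrow> X (\<sigma> \<omega>) \<omega>" if "\<omega> \<in> space M" for \<omega>
  proof (rule continuous_on_tendsto_compose[OF c[OF that]])
    have "(\<lambda>n. r n \<omega> - \<sigma> \<omega>) \<longlonglongrightarrow> 0"
      using r_bounds(2)[OF that] by (intro Lim_null_comparison[OF _ lim_1_over_n[THEN LIMSEQ_Suc]]) auto
    then show "(\<lambda>n. r n \<omega>) \<longlonglongrightarrow> \<sigma> \<omega>" by (simp add: LIM_zero_iff)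
  qed (use r_bounds[OF that] \<sigma>_range[OF that] in auto)
  show "(\<lambda>\<omega>. X (r n \<omega>) \<omega>) \<in> borel_measurable M" for n
  proof -
    define Y where "Y k = X (max 0 (min 1 (real_of_int k / Suc n)))" for k :: int
    have [measurable]: "Y k \<in> borel_measurable M" for k unfolding Y_def by (rule X) auto
    have "(\<lambda>\<omega>. Y \<lfloor>Suc n * \<sigma> \<omega>\<rfloor> \<omega>) \<in> borel_measurable M"
      by (rule measurable_compose_countable) auto
    moreover have "Y \<lfloor>Suc n * \<sigma> \<omega>\<rfloor> \<omega> = X (r n \<omega>) \<omega>" if "\<omega> \<in> space M" for \<omega>
      using r_bounds(1)[OF that, of n] by (simp add: Y_def r_def)
    ultimately show ?thesis by (subst (asm) measurable_cong) auto
  qed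
qed

lemma (in standard_brownian_motion) measurable_vervaat:
  "(\<lambda>\<omega>. vervaat (\<lambda>s. B s \<omega>) t) \<in> borel_measurable M"
proof -
  let ?\<tau> = "\<lambda>\<omega>. first_argmin (\<lambda>s. B s \<omega>)"
  have \<tau>[measurable]: "?\<tau> \<in> borel_measurable M"
  proof (rule borel_measurableI_le)
    fix s :: real
    consider "s < 0" | "s > 1" | "s \<in> {0..1}" by force
    then show "{\<omega> \<in> space M. ?\<tau> \<omega> \<le> s} \<in> sets M"
    proof cases
      case 1
      then have "{\<omega> \<in> space M. ?\<tau> \<omega> \<le> s} = {}"
        using first_argmin(1)[OF continuous_paths] by force
      then show ?thesis by (simp only: sets.empty_sets)
    next
      case 2
      then have "{\<omega> \<in> space M. ?\<tau> \<omega> \<le> s} = space M"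
        using first_argmin(1)[OF continuous_paths] by force
      then show ?thesis by (simp only: sets.top)
    next
      case 3
      have "{\<omega> \<in> space M. ?\<tau> \<omega> \<le> s} = {\<omega> \<in> space M.
          \<forall>q\<in>\<rat> \<inter> {0..1}. \<forall>n::nat. \<exists>p\<in>\<rat> \<inter> {0..s}. B p \<omega> < B q \<omega> + 1 / Suc n}"
        using first_argmin_le_iff[OF continuous_paths 3] by blast
      also have "\<dots> \<in> sets M"
      proof (intro sets.sets_Collect_countable_All' sets.sets_Collect_countable_All
          sets.sets_Collect_countable_Ex')
        fix p q :: real and n :: nat
        assume "q \<in> \<rat> \<inter> {0..1}" "p \<in> \<rat> \<inter> {0..s}"
        with 3 have [measurable]: "B p \<in> borel_measurable M" "B q \<in> borel_measurable M"
          by (auto intro!: random_variable_B)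
        show "{\<omega> \<in> space M. B p \<omega> < B q \<omega> + 1 / Suc n} \<in> sets M" by measurable
      qed (auto simp: countable_rat)
      finally show ?thesis .
    qed
  qed
  have [measurable]: "B 1 \<in> borel_measurable M" by (rule random_variable_B) simp
  note at_time = measurable_at_random_time[OF random_variable_B continuous_paths]
  have [measurable]: "(\<lambda>\<omega>. B (?\<tau> \<omega>) \<omega>) \<in> borel_measurable M"
    using first_argmin(1)[OF continuous_paths] by (intro at_time \<tau>) auto
  have "(\<lambda>\<omega>. frac (?\<tau> \<omega> + t)) \<in> borel_measurable M"
    unfolding frac_def by measurable
  then have [measurable]: "(\<lambda>\<omega>. B (frac (?\<tau> \<omega> + t)) \<omega>) \<in> borel_measurable M"
    by (rule at_time[rotated 2]) (auto intro: less_imp_le frac_lt_1)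
  show ?thesis unfolding vervaat_def by measurable
qed

end

theory Submission
  imports Defs
begin

text \<open>Write \<open>V\<close> for the Vervaat transform of \<open>B\<close> and \<open>\<tau>\<close> for the first argmin of \<open>B\<close>. On the time interval
from \<open>1 - \<tau>\<close> to \<open>1\<close> the path of \<open>V\<close> is the path of \<open>B\<close> before its minimum, so \<open>V 1\<close> is the
minimum of \<open>V\<close> there, while before \<open>1 - \<tau>\<close> the transform is nonnegative. Hence a negative value
\<open>V r < 0\<close> forces \<open>V 1 \<le> 0\<close> (lemma \<open>vervaat_end_le_0\<close>). The past of \<open>V\<close> thus carries information
on \<open>V 1\<close> that the present value \<open>V s\<close>, \<open>r < s < 1\<close>, does not show.

If \<open>V\<close> were Markov, then \<open>P(V 1 > 0 | past of s)\<close> would be a function of \<open>V s\<close>. It vanishes where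
\<open>V r < 0\<close>, so a single Borel set \<open>N\<close> would contain \<open>V s\<close> almost surely on \<open>{V r < 0}\<close> and would miss
\<open>V s\<close> almost surely on \<open>{V 1 > 0}\<close> (lemma \<open>markov_process_separation\<close>): the laws of \<open>V s\<close> on these
two events would be mutually singular. They are not, for \<open>r = 7/20\<close> and \<open>s = 11/20\<close>.

Restrict to paths that make a deep, steep V-shaped valley on \<open>{1/2..1}\<close> with bottom near \<open>4/5\<close>. If
the global minimum lies in that valley, its position \<open>\<tau>\<close> is determined by the increments after time
\<open>1/2\<close>, and \<open>V s = B (\<tau> - 9/20) + B 1 - B \<tau>\<close> with \<open>\<tau> - 9/20\<close> between \<open>3/10\<close> and \<open>2/5\<close>. This
\<open>rotated_value\<close> does not involve the increments over \<open>{2/5..1/2}\<close>, and it is the sum of the Gaussian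
increment \<open>b = B (3/10) - B (1/5)\<close> and of a variable independent of \<open>b\<close>. If the path dips below \<open>-5\<close>
during \<open>{1/10..1/5}\<close>, then \<open>V r < 0\<close> as soon as the minimum is in the valley.

The position of the minimum is under control once the path is bounded by \<open>L\<close> up to \<open>2/5\<close> and then
drops by about \<open>2 L\<close> over \<open>{2/5..1/2}\<close>. That drop is independent of \<open>rotated_value\<close> and of the dip, and
has positive probability for every \<open>L\<close>, so \<open>rotated_value\<close> lies in \<open>N\<close> almost surely on the dip event
with any bound \<open>L\<close>, hence on the whole dip event (lemma \<open>dip_event_values_null\<close>). There \<open>b\<close> is
unconstrained; its density is positive everywhere, so \<open>- N\<close> is a Lebesgue null set, and then
\<open>rotated_value\<close> almost surely avoids \<open>- N\<close> (lemma \<open>AE_rotated_value_notin\<close>). But some paths rise to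
\<open>3\<close>, then have their minimum in the valley, and end near \<open>1\<close>: for those \<open>V s\<close> is \<open>rotated_value\<close> and
\<open>V 1 > 0\<close>, which requires a value in \<open>- N\<close>.

All positivity claims come from the support theorem (\<open>support_theorem\<close>): Brownian motion stays in any
tube around a Lipschitz function with positive probability.\<close>

section \<open>Separation of past and future under the Markov property\<close>

lemma set_integral_zero_imp_AE_zero:
  fixes f :: "'a \<Rightarrow> real"
  assumes "integrable M f" "AE x in M. 0 \<le> f x" "A \<in> sets M" "(\<integral>x\<in>A. f x \<partial>M) = 0"
  shows "AE x in M. x \<in> A \<longrightarrow> f x = 0"
proof -
  have "integrable M (\<lambda>x. indicator A x *\<^sub>R f x)"
    using assms(3,1) by (rule integrable_mult_indicator)
  moreover have "AE x in M. 0 \<le> indicator A x *\<^sub>R f x"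
    using assms(2) by eventually_elim (auto simp: indicator_def)
  ultimately have "AE x in M. indicator A x *\<^sub>R f x = 0"
    using assms(4) by (simp add: set_lebesgue_integral_def integral_nonneg_eq_0_iff_AE)
  then show ?thesis by eventually_elim (auto simp: indicator_def split: if_splits)
qed

text \<open>If \<open>X r \<in> C\<close> excludes \<open>X t \<in> A\<close>, then the conditional probability of \<open>X t \<in> A\<close> given the past of \<open>s\<close>
vanishes on \<open>X r \<in> C\<close>. For a Markov process it is a function of \<open>X s\<close>, and \<open>N\<close> is the zero set of
that function.\<close>

lemma markov_process_separation:
  fixes X :: "real \<Rightarrow> 'a \<Rightarrow> real"
  assumes "prob_space M" and markov: "markov_process M T X"
    and time: "r \<in> T" "s \<in> T" "t \<in> T" "r \<le> s" "s \<le> t"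
    and [measurable]: "A \<in> sets borel" "C \<in> sets borel"
    and disj: "AE \<omega> in M. \<not> (X r \<omega> \<in> C \<and> X t \<omega> \<in> A)"
  obtains N :: "real set" where "N \<in> sets borel"
    "AE \<omega> in M. X r \<omega> \<in> C \<longrightarrow> X s \<omega> \<in> N"
    "AE \<omega> in M. X t \<omega> \<in> A \<longrightarrow> X s \<omega> \<notin> N"
proof -
  interpret prob_space M by fact
  have X[measurable]: "X u \<in> borel_measurable M" if "u \<in> T" for u
    using markov that by (simp add: markov_process_def)
  note [measurable] = X[OF time(1)] X[OF time(2)] X[OF time(3)]
  define F where "F = natural_filtration M T X s"
  define H where "H = vimage_algebra (space M) (X s) borel"
  define f where "f \<omega> = (indicator A (X t \<omega>) :: real)" for \<omega>
  have gen: "{X u -` A \<inter> space M |u A. u \<in> T \<and> u \<le> s \<and> A \<in> sets borel} \<subseteq> sets M"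
    by (auto intro: measurable_sets[OF X])
  have F: "subalgebra M F"
    using gen unfolding subalgebra_def F_def natural_filtration_def
    by (auto simp: space_measure_of_conv sets.sigma_sets_subset
      dest: subsetD[OF sets.sigma_sets_subset[OF gen]] simp: sets_measure_of[OF order_trans[OF gen sets.space_closed]])
  have H: "subalgebra M H"
    by (auto simp: subalgebra_def H_def sets_vimage_algebra2)
  interpret F: finite_measure_subalgebra M F by unfold_locales fact
  interpret H: finite_measure_subalgebra M H by unfold_locales fact
  have f[measurable]: "f \<in> borel_measurable M" unfolding f_def by measurable
  have int: "integrable M f"
    by (rule integrable_const_bound[of _ 1]) (auto simp: f_def indicator_def)
  define N where "N = {\<omega> \<in> space M. real_cond_exp M H f \<omega> = 0}"
  have "{\<omega> \<in> space H. real_cond_exp M H f \<omega> = 0} \<in> sets H" by measurable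
  then have NH: "N \<in> sets H" unfolding N_def H_def by simp
  then obtain N' where N': "N' \<in> sets borel" "N = X s -` N' \<inter> space M"
    unfolding H_def by (subst (asm) sets_vimage_algebra2) auto
  have UF: "X r -` C \<inter> space M \<in> sets F" (is "?U \<in> _")
    unfolding F_def natural_filtration_def
    by (subst sets_measure_of[OF order_trans[OF gen sets.space_closed]])
       (use time in \<open>auto intro!: sigma_sets.Basic exI[of _ r] exI[of _ C]\<close>)
  have "AE \<omega> in M. \<omega> \<in> ?U \<longrightarrow> real_cond_exp M F f \<omega> = 0"
  proof (rule set_integral_zero_imp_AE_zero)
    show "integrable M (real_cond_exp M F f)" using int by (rule F.real_cond_exp_int)
    show "AE \<omega> in M. 0 \<le> real_cond_exp M F f \<omega>" by (rule F.real_cond_exp_pos) (auto simp: f_def)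
    show "?U \<in> sets M" by measurable
    have "(\<integral>\<omega>\<in>?U. f \<omega> \<partial>M) = 0"
      unfolding set_lebesgue_integral_def using disj
      by (intro integral_eq_zero_AE) (auto simp: f_def indicator_def elim: eventually_mono)
    then show "(\<integral>\<omega>\<in>?U. real_cond_exp M F f \<omega> \<partial>M) = 0"
      using F.real_cond_exp_intA[OF int UF] by simp
  qed
  moreover have "AE \<omega> in M. real_cond_exp M F f \<omega> = real_cond_exp M H f \<omega>"
    using markov time \<open>A \<in> sets borel\<close> unfolding markov_process_def F_def H_def f_def by blast
  ultimately have 1: "AE \<omega> in M. X r \<omega> \<in> C \<longrightarrow> X s \<omega> \<in> N'"
    using AE_space by eventually_elim (use N' N_def in auto)
  have "AE \<omega> in M. \<omega> \<in> N \<longrightarrow> f \<omega> = 0"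
  proof (rule set_integral_zero_imp_AE_zero[OF int])
    show "N \<in> sets M" using NH H by (auto simp: subalgebra_def)
    have "(\<integral>\<omega>\<in>N. real_cond_exp M H f \<omega> \<partial>M) = 0"
      unfolding set_lebesgue_integral_def
      by (rule integral_eq_zero_AE) (auto simp: N_def indicator_def)
    then show "(\<integral>\<omega>\<in>N. f \<omega> \<partial>M) = 0"
      using H.real_cond_exp_intA[OF int NH] by simp
  qed (auto simp: f_def)
  then have 2: "AE \<omega> in M. X t \<omega> \<in> A \<longrightarrow> X s \<omega> \<notin> N'"
    using AE_space by eventually_elim (use N' in \<open>auto simp: f_def\<close>)
  from that[OF N'(1) 1 2] show thesis .
qed

section \<open>Increments over almost disjoint time sets\<close>

context standard_brownian_motion
begin

text \<open>Two parameters are needed because independence is first obtained for increments between points of a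
finite grid \<open>D\<close>; \<open>S\<close> is the time set that must contain the whole interval of the increment.\<close>

definition increment_events :: "real set \<Rightarrow> real set \<Rightarrow> 'a set set" where
  "increment_events D S =
     {(\<lambda>\<omega>. B t \<omega> - B s \<omega>) -` A \<inter> space M | s t A.
        s \<in> D \<and> t \<in> D \<and> s \<le> t \<and> {s..t} \<subseteq> S \<and> A \<in> sets borel}"

definition increments_over :: "real set \<Rightarrow> 'a measure" where
  "increments_over S = sigma (space M) (increment_events {0..1} S)"

lemma increment_events_subset: "D \<subseteq> {0..1} \<Longrightarrow> increment_events D S \<subseteq> events"
proof -
  assume D: "D \<subseteq> {0..1}"
  have "(\<lambda>\<omega>. B t \<omega> - B s \<omega>) \<in> borel_measurable M" if "s \<in> D" "t \<in> D" for s t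
    using that D by (intro borel_measurable_diff random_variable_B) auto
  then show ?thesis by (auto simp: increment_events_def intro: measurable_sets)
qed

lemma increment_events_mono:
  "D \<subseteq> D' \<Longrightarrow> S \<subseteq> S' \<Longrightarrow> increment_events D S \<subseteq> increment_events D' S'"
  unfolding increment_events_def by blast

lemma space_increments_over[simp]: "space (increments_over S) = space M"
  by (simp add: increments_over_def space_measure_of_conv)

lemma sets_increments_over:
  "sets (increments_over S) = sigma_sets (space M) (increment_events {0..1} S)"
  unfolding increments_over_def
  using increment_events_subset[of "{0..1}" S] sets.space_closed[of M]
  by (intro sets_measure_of) auto

lemma increments_over_subset: "sets (increments_over S) \<subseteq> events"
  unfolding sets_increments_over by (intro sets.sigma_sets_subset increment_events_subset) simp

lemma increments_over_mono: "S \<subseteq> S' \<Longrightarrow> sets (increments_over S) \<subseteq> sets (increments_over S')"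
  unfolding sets_increments_over by (intro sigma_sets_mono' increment_events_mono) auto

lemma measurable_increment:
  assumes "0 \<le> s" "s \<le> t" "t \<le> 1" "{s..t} \<subseteq> S"
  shows "(\<lambda>\<omega>. B t \<omega> - B s \<omega>) \<in> borel_measurable (increments_over S)"
proof (rule measurableI)
  fix A :: "real set" assume "A \<in> sets borel"
  with assms show "(\<lambda>\<omega>. B t \<omega> - B s \<omega>) -` A \<inter> space (increments_over S) \<in> sets (increments_over S)"
    unfolding sets_increments_over
    by (intro sigma_sets.Basic, unfold increment_events_def)
       (intro CollectI exI[of _ s] exI[of _ t] exI[of _ A], auto)
qed simp

text \<open>Every increment between grid points is a sum of the increments over the elementary grid intervals.
A nondegenerate interval is infinite and cannot lie in \<open>S1 \<inter> S2\<close>, so the two families use disjoint sets of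
elementary increments, which are independent.\<close>

lemma indep_increment_events_grid:
  assumes D: "finite D" "D \<subseteq> {0..1}" and fin: "finite (S1 \<inter> S2)"
  shows "indep_set (sigma_sets (space M) (increment_events D S1))
    (sigma_sets (space M) (increment_events D S2))"
proof -
  define D' where "D' = insert 0 D"
  define xs where "xs = sorted_list_of_set D'"
  define t where "t i = xs ! i" for i
  define n where "n = length xs - 1"
  have D': "finite D'" "D' \<noteq> {}" "D' \<subseteq> {0..1}" using D by (auto simp: D'_def)
  then have xs: "set xs = D'" "xs \<noteq> []" by (auto simp: xs_def)
  then have len: "length xs = Suc n" by (simp add: n_def)
  have mono: "t i < t j" if "i < j" "j \<le> n" for i j
    using that len sorted_wrt_nth_less[of "(<)" xs i j] by (simp add: t_def xs_def)
  have range: "t ` {..n} = D'"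
    using xs len by (auto simp: t_def set_conv_nth less_Suc_eq_le image_iff)
  define inc where "inc i \<omega> = B (t (Suc i)) \<omega> - B (t i) \<omega>" for i \<omega>
  have indep: "indep_vars (\<lambda>_. borel) inc {..<n}"
    unfolding inc_def using D' range mono
    by (intro independent_increments) (auto simp: strict_mono_on_def)
  define I where "I S = {i. i < n \<and> {t i..t (Suc i)} \<subseteq> S}" for S
  define U where "U S \<omega> = restrict (\<lambda>i. inc i \<omega>) (I S)" for S \<omega>
  have disj: "I S1 \<inter> I S2 = {}"
  proof safe
    fix i assume "i \<in> I S1" "i \<in> I S2"
    then have "i < n" and sub: "{t i..t (Suc i)} \<subseteq> S1 \<inter> S2" by (auto simp: I_def)
    then have "infinite {t i..t (Suc i)}" using mono[of i "Suc i"] by (simp add: infinite_Icc)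
    with finite_subset[OF sub fin] show "i \<in> {}" by blast
  qed
  have iv: "indep_var (PiM (I S1) (\<lambda>_. borel)) (U S1) (PiM (I S2) (\<lambda>_. borel)) (U S2)"
    unfolding U_def by (rule indep_var_restrict[OF indep disj]) (auto simp: I_def)
  define E where "E S = {U S -` A \<inter> space M | A. A \<in> sets (PiM (I S) (\<lambda>_. borel :: real measure))}" for S
  have U: "U S \<in> measurable M (PiM (I S) (\<lambda>_. borel))" for S
    unfolding U_def using indep by (intro measurable_restrict) (auto simp: indep_vars_def I_def)
  have sub: "increment_events D S \<subseteq> E S" for S
  proof
    fix Y assume "Y \<in> increment_events D S"
    then obtain u v A where Y: "Y = (\<lambda>\<omega>. B v \<omega> - B u \<omega>) -` A \<inter> space M" "u \<in> D'" "v \<in> D'"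
        "u \<le> v" "{u..v} \<subseteq> S" "A \<in> sets borel"
      by (auto simp: increment_events_def D'_def)
    have "u \<in> t ` {..n}" "v \<in> t ` {..n}" using Y(2,3) by (simp_all add: range)
    then obtain a b where ab: "u = t a" "v = t b" "a \<le> n" "b \<le> n" by auto
    have "a \<le> b" using mono[of b a] ab \<open>u \<le> v\<close> by (intro leI) auto
    define g where "g y = (\<Sum>k\<in>{a..<b}. y k)" for y :: "nat \<Rightarrow> real"
    have le: "t i \<le> t j" if "i \<le> j" "j \<le> n" for i j
      using mono[of i j] that by (cases "i = j") (auto simp: less_imp_le)
    have sub: "{a..<b} \<subseteq> I S"
    proof
      fix k assume k: "k \<in> {a..<b}"
      then have "u \<le> t k" "t (Suc k) \<le> v" using ab by (auto intro!: le)
      with Y(5) k ab show "k \<in> I S" by (auto simp: I_def)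
    qed
    have g: "g \<in> borel_measurable (PiM (I S) (\<lambda>_. borel))"
      unfolding g_def by (intro borel_measurable_sum measurable_component_singleton) (use sub in auto)
    have "g (U S \<omega>) = B v \<omega> - B u \<omega>" for \<omega>
    proof -
      have "g (U S \<omega>) = (\<Sum>k\<in>{a..<b}. inc k \<omega>)"
        unfolding g_def U_def using sub by (intro sum.cong) auto
      also have "\<dots> = B v \<omega> - B u \<omega>"
        unfolding inc_def ab using sum_Suc_diff'[OF \<open>a \<le> b\<close>, of "\<lambda>k. B (t k) \<omega>"] by simp
      finally show ?thesis .
    qed
    then have "Y = U S -` (g -` A \<inter> space (PiM (I S) (\<lambda>_. borel))) \<inter> space M"
      using measurable_space[OF U, of _ S] Y(1) by auto
    with measurable_sets[OF g Y(6)] show "Y \<in> E S" unfolding E_def by blast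
  qed
  have "indep_set (sigma_sets (space M) (E S1)) (sigma_sets (space M) (E S2))"
    using iv unfolding indep_var_eq E_def by simp
  then show ?thesis
    unfolding indep_set_def using sub
    by (elim indep_sets_mono_sets) (auto split: bool.split dest: subsetD[OF sigma_sets_mono'[OF sub]])
qed

text \<open>The \<sigma>-algebras of the finite grids form a directed family, whose union is stable under
intersection; independence therefore passes from the grids to the generated \<sigma>-algebras.\<close>

lemma indep_increments_over:
  assumes fin: "finite (S1 \<inter> S2)"
  shows "indep_set (sets (increments_over S1)) (sets (increments_over S2))"
proof -
  define \<A> where "\<A> S = (\<Union>D\<in>{D. finite D \<and> D \<subseteq> {0..1}}. sigma_sets (space M) (increment_events D S))"
    for S
  have two: "\<exists>D. finite D \<and> D \<subseteq> {0..1} \<and> X \<in> sigma_sets (space M) (increment_events D S)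
      \<and> Y \<in> sigma_sets (space M) (increment_events D S')"
    if "X \<in> \<A> S" "Y \<in> \<A> S'" for X Y S S'
  proof -
    from that obtain D D' where *: "finite D" "D \<subseteq> {0..1}" "finite D'" "D' \<subseteq> {0..1}"
      "X \<in> sigma_sets (space M) (increment_events D S)"
      "Y \<in> sigma_sets (space M) (increment_events D' S')"
      by (auto simp: \<A>_def)
    note mono = sigma_sets_mono'[OF increment_events_mono, THEN subsetD]
    show ?thesis
      using *(1-4) by (intro exI[of _ "D \<union> D'"] conjI mono[OF _ _ *(5)] mono[OF _ _ *(6)]) auto
  qed
  have \<A>: "\<A> S \<subseteq> events" for S
    unfolding \<A>_def by (intro UN_least sets.sigma_sets_subset increment_events_subset) auto
  have stable: "Int_stable (\<A> S)" for S
  proof (rule Int_stableI)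
    fix X Y assume "X \<in> \<A> S" "Y \<in> \<A> S"
    from two[OF this] obtain D where D: "finite D" "D \<subseteq> {0..1}"
      "X \<in> sigma_sets (space M) (increment_events D S)"
      "Y \<in> sigma_sets (space M) (increment_events D S)" by auto
    interpret sigma_algebra "space M" "sigma_sets (space M) (increment_events D S)"
      using increment_events_subset[OF D(2), of S] sets.space_closed
      by (intro sigma_algebra_sigma_sets) auto
    show "X \<inter> Y \<in> \<A> S" using D by (auto simp: \<A>_def)
  qed
  have "indep_set (\<A> S1) (\<A> S2)"
  proof (rule indep_setI)
    fix X Y assume "X \<in> \<A> S1" "Y \<in> \<A> S2"
    from two[OF this] obtain D where D: "finite D" "D \<subseteq> {0..1}"
      "X \<in> sigma_sets (space M) (increment_events D S1)"
      "Y \<in> sigma_sets (space M) (increment_events D S2)" by auto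
    then show "prob (X \<inter> Y) = prob X * prob Y"
      using indep_increment_events_grid[OF D(1,2) fin] by (intro indep_setD)
  qed (rule \<A>)+
  then have ind: "indep_set (sigma_sets (space M) (\<A> S1)) (sigma_sets (space M) (\<A> S2))"
    by (rule indep_set_sigma_sets) (rule stable)+
  have sub: "sets (increments_over S) \<subseteq> sigma_sets (space M) (\<A> S)" for S
    unfolding sets_increments_over
  proof (rule sigma_sets_mono')
    show "increment_events {0..1} S \<subseteq> \<A> S"
    proof
      fix Y assume Y: "Y \<in> increment_events {0..1} S"
      then obtain s t where st: "s \<in> {0..1}" "t \<in> {0..1}" "Y \<in> increment_events {s, t} S"
        unfolding increment_events_def by blast
      then show "Y \<in> \<A> S" unfolding \<A>_def by (intro UN_I[of "{s, t}"] sigma_sets.Basic) auto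
    qed
  qed
  show ?thesis
    using ind unfolding indep_set_def
    by (elim indep_sets_mono_sets) (auto split: bool.split dest: subsetD[OF sub])
qed

lemma prob_indep_increments_over:
  assumes "finite (S1 \<inter> S2)" "X \<in> sets (increments_over S1)" "Y \<in> sets (increments_over S2)"
  shows "prob (X \<inter> Y) = prob X * prob Y"
  using indep_increments_over[OF assms(1)] assms(2,3) by (rule indep_setD)

end

section \<open>Tubes around Lipschitz functions\<close>

lemma std_normal_tail_pos:
  "emeasure (density lborel std_normal_density) {x. K \<le> \<sigma> * x} > 0" if "\<sigma> \<in> {1, -1}" for \<sigma> :: real
proof -
  have "emeasure lborel {x. K \<le> \<sigma> * x} \<noteq> 0"
  proof -
    have "{K..K+1} \<subseteq> {x. K \<le> \<sigma> * x} \<or> {-K-1..-K} \<subseteq> {x. K \<le> \<sigma> * x}" using that by auto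
    then obtain a :: real where "{a..a+1} \<subseteq> {x. K \<le> \<sigma> * x}" by (metis diff_add_cancel)
    then have "emeasure lborel {a..a+1} \<le> emeasure lborel {x. K \<le> \<sigma> * x}"
      by (intro emeasure_mono) auto
    then show ?thesis by auto
  qed
  then have "\<not> (AE x in lborel. K \<le> \<sigma> * x \<longrightarrow> ennreal (std_normal_density x) = 0)"
    using normal_density_pos[of 1 0] by (simp add: AE_iff_measurable[OF _ refl] less_imp_neq[THEN not_sym])
  then have "{x. K \<le> \<sigma> * x} \<notin> null_sets (density lborel std_normal_density)"
    by (subst null_sets_density_iff) auto
  then show ?thesis by (auto simp: null_sets_def zero_less_iff_neq_zero)
qed

text \<open>Closed conditions on a continuous path need only be checked at rational times.\<close>

lemma sets_path_le:
  fixes Y :: "real \<Rightarrow> 'a \<Rightarrow> real"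
  assumes "a \<le> b" and Y: "\<And>t. t \<in> {a..b} \<Longrightarrow> Y t \<in> borel_measurable N"
    and cont: "\<And>\<omega>. \<omega> \<in> space N \<Longrightarrow> continuous_on {a..b} (\<lambda>t. Y t \<omega>)"
  shows "{\<omega> \<in> space N. \<forall>t\<in>{a..b}. Y t \<omega> \<le> c} \<in> sets N"
proof (cases "a = b")
  case True
  have [measurable]: "Y b \<in> borel_measurable N" using Y True by simp
  show ?thesis using True by simp
next
  case False
  with \<open>a \<le> b\<close> have cl: "closure ({a<..<b} \<inter> \<rat>) = {a..b}"
    using closure_open_Int_superset[of "{a<..<b}" "\<rat>"] by (simp add: Rats_closure_real)
  have "{\<omega> \<in> space N. \<forall>t\<in>{a..b}. Y t \<omega> \<le> c} = {\<omega> \<in> space N. \<forall>t\<in>{a<..<b} \<inter> \<rat>. Y t \<omega> \<le> c}"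
  proof (intro Collect_cong conj_cong refl iffI ballI)
    fix \<omega> t assume "\<omega> \<in> space N" "\<forall>t\<in>{a<..<b} \<inter> \<rat>. Y t \<omega> \<le> c" "t \<in> {a..b}"
    then show "Y t \<omega> \<le> c"
      using continuous_le_on_closure[of "{a<..<b} \<inter> \<rat>" "\<lambda>t. Y t \<omega>" t c] cont cl by auto
  qed auto
  also have "\<dots> \<in> sets N"
  proof (intro sets.sets_Collect_countable_All')
    fix t assume "t \<in> {a<..<b} \<inter> \<rat>"
    then have [measurable]: "Y t \<in> borel_measurable N" by (intro Y) auto
    show "{\<omega> \<in> space N. Y t \<omega> \<le> c} \<in> sets N" by measurable
  qed (auto simp: countable_rat)
  finally show ?thesis .
qed

context standard_brownian_motion
begin

lemma continuous_B: "\<omega> \<in> space M \<Longrightarrow> S \<subseteq> {0..1} \<Longrightarrow> continuous_on S (\<lambda>t. B t \<omega>)"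
  using continuous_paths by (rule continuous_on_subset)

lemma measurable_B:
  assumes "0 \<le> t" "t \<le> 1" "{0..t} \<subseteq> S"
  shows "B t \<in> borel_measurable (increments_over S)"
proof -
  have "B t \<omega> - B 0 \<omega> = B t \<omega>" if "\<omega> \<in> space M" for \<omega> using start_zero[OF that] by simp
  then show ?thesis
    using measurable_increment[of 0 t S] assms by (subst measurable_cong) auto
qed

text \<open>The bound is uniform in \<open>s\<close> and \<open>t\<close>: on the standardized scale the threshold \<open>K * (t - s)\<close> becomes
\<open>K * sqrt (t - s)\<close>, which is at most \<open>K\<close>. The sign \<open>\<sigma>\<close> treats both tails at once.\<close>

lemma increment_tail:
  assumes st: "0 \<le> s" "s < t" "t \<le> 1" and "0 \<le> K" "\<sigma> \<in> {1, -1}"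
  shows "measure (density lborel std_normal_density) {x. K \<le> \<sigma> * x}
    \<le> prob {\<omega> \<in> space M. K * (t - s) \<le> \<sigma> * (B t \<omega> - B s \<omega>)}"
proof -
  define X where "X \<omega> = (B t \<omega> - B s \<omega>) / sqrt (t - s)" for \<omega>
  have X: "distributed M lborel X std_normal_density"
    using normal_increments[OF st] st
      normal_standard_normal_convert[of "sqrt (t - s)" "\<lambda>\<omega>. B t \<omega> - B s \<omega>" 0]
    by (simp add: X_def[abs_def])
  have [measurable]: "X \<in> borel_measurable M" using distributed_measurable[OF X] by simp
  have [measurable]: "B t \<in> borel_measurable M" "B s \<in> borel_measurable M"
    using st by (auto intro!: random_variable_B)
  have "measure (density lborel std_normal_density) {x. K \<le> \<sigma> * x} = measure (distr M lborel X) {x. K \<le> \<sigma> * x}"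
    using distributed_distr_eq_density[OF X] by simp
  also have "\<dots> = prob {\<omega> \<in> space M. K \<le> \<sigma> * X \<omega>}"
    by (subst measure_distr) (auto intro!: arg_cong[where f=prob])
  also have "\<dots> \<le> prob {\<omega> \<in> space M. K * (t - s) \<le> \<sigma> * (B t \<omega> - B s \<omega>)}"
  proof (rule finite_measure_mono)
    show "{\<omega> \<in> space M. K \<le> \<sigma> * X \<omega>} \<subseteq> {\<omega> \<in> space M. K * (t - s) \<le> \<sigma> * (B t \<omega> - B s \<omega>)}"
    proof safe
      fix \<omega> assume "K \<le> \<sigma> * X \<omega>"
      then have "K * sqrt (t - s) \<le> \<sigma> * (B t \<omega> - B s \<omega>)"
        using st by (simp add: X_def field_simps)
      moreover have "t - s \<le> sqrt (t - s)"
        using st by (intro real_le_rsqrt) (auto simp: power2_eq_square intro: mult_left_le)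
      ultimately show "K * (t - s) \<le> \<sigma> * (B t \<omega> - B s \<omega>)"
        using \<open>0 \<le> K\<close> by (meson mult_left_mono order_trans)
    qed
  qed measurable
  finally show ?thesis .
qed

text \<open>Paths are uniformly continuous, so the events increase to the whole space. Rational times make the
events measurable, and suffice since the grid points used below are rational.\<close>

lemma oscillation_tendsto_1:
  assumes e: "0 < e"
  shows "(\<lambda>n. prob {\<omega> \<in> space M. \<forall>s\<in>\<rat> \<inter> {0..1}. \<forall>t\<in>\<rat> \<inter> {0..1}.
    \<bar>s - t\<bar> \<le> 1 / real (Suc n) \<longrightarrow> \<bar>B s \<omega> - B t \<omega>\<bar> \<le> e}) \<longlonglongrightarrow> 1" (is "(\<lambda>n. prob (?E n)) \<longlonglongrightarrow> 1")
    and "\<And>n. {\<omega> \<in> space M. \<forall>s\<in>\<rat> \<inter> {0..1}. \<forall>t\<in>\<rat> \<inter> {0..1}.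
    \<bar>s - t\<bar> \<le> 1 / real (Suc n) \<longrightarrow> \<bar>B s \<omega> - B t \<omega>\<bar> \<le> e} \<in> events"
proof -
  show meas: "?E n \<in> events" for n
  proof (intro sets.sets_Collect_countable_All')
    fix s t :: real assume "s \<in> \<rat> \<inter> {0..1}" "t \<in> \<rat> \<inter> {0..1}"
    then have [measurable]: "B s \<in> borel_measurable M" "B t \<in> borel_measurable M"
      by (auto intro!: random_variable_B)
    show "{\<omega> \<in> space M. \<bar>s - t\<bar> \<le> 1 / real (Suc n) \<longrightarrow> \<bar>B s \<omega> - B t \<omega>\<bar> \<le> e} \<in> events" by measurable
  qed (auto simp: countable_rat)
  have mono: "incseq ?E"
  proof (intro monoI Collect_mono impI conjI ballI)
    fix m n :: nat and \<omega> and s t :: real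
    assume mn: "m \<le> n" and *: "\<omega> \<in> space M \<and> (\<forall>s\<in>\<rat> \<inter> {0..1}. \<forall>t\<in>\<rat> \<inter> {0..1}.
      \<bar>s - t\<bar> \<le> 1 / real (Suc m) \<longrightarrow> \<bar>B s \<omega> - B t \<omega>\<bar> \<le> e)"
      and st: "s \<in> \<rat> \<inter> {0..1}" "t \<in> \<rat> \<inter> {0..1}" "\<bar>s - t\<bar> \<le> 1 / real (Suc n)"
    have "1 / real (Suc n) \<le> 1 / real (Suc m)" using mn by (simp add: frac_le)
    with * st show "\<bar>B s \<omega> - B t \<omega>\<bar> \<le> e" by (meson order_trans)
  qed simp
  have un: "(\<Union>n. ?E n) = space M"
  proof safe
    fix \<omega> assume \<omega>: "\<omega> \<in> space M"
    have "uniformly_continuous_on {0..1} (\<lambda>t. B t \<omega>)"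
      using continuous_paths[OF \<omega>] by (intro compact_uniformly_continuous) auto
    with e obtain d where d: "d > 0" "\<And>s t. s \<in> {0..1} \<Longrightarrow> t \<in> {0..1} \<Longrightarrow> dist t s < d \<Longrightarrow> dist (B t \<omega>) (B s \<omega>) < e"
      unfolding uniformly_continuous_on_def by metis
    obtain n where n: "1 / real (Suc n) < d" using nat_approx_posE[OF d(1)] by auto
    have "\<omega> \<in> ?E n"
    proof (intro CollectI conjI ballI impI \<omega>)
      fix s t assume st: "s \<in> \<rat> \<inter> {0..1}" "t \<in> \<rat> \<inter> {0..1}" "\<bar>s - t\<bar> \<le> 1 / real (Suc n)"
      then show "\<bar>B s \<omega> - B t \<omega>\<bar> \<le> e" using d(2)[of t s] n by (auto simp: dist_real_def)
    qed
    then show "\<omega> \<in> (\<Union>n. ?E n)" by blast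
  qed
  show "(\<lambda>n. prob (?E n)) \<longlonglongrightarrow> 1"
    using finite_Lim_measure_incseq[OF _ mono] meas unfolding un by (auto simp: prob_space)
qed

text \<open>A step over a short interval may be required to move at least \<open>K / n\<close> in a prescribed direction without
oscillating by more than \<open>e\<close>: the probability of the first condition is bounded below independently of
\<open>n\<close>, while the second one fails with a probability that tends to \<open>0\<close>.\<close>

lemma steps_possible:
  assumes "0 \<le> K" "0 < e"
  obtains n where "n > 0" "K / real n \<le> e"
    "\<And>i \<sigma>. i < n \<Longrightarrow> \<sigma> \<in> {1, -1} \<Longrightarrow>
      prob {\<omega> \<in> space M. K / n \<le> \<sigma> * (B (Suc i / n) \<omega> - B (i / n) \<omega>) \<and>
        (\<forall>u\<in>{i / n..Suc i / n}. \<bar>B u \<omega> - B (i / n) \<omega>\<bar> \<le> e)} > 0"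
proof -
  define p where "p \<sigma> = measure (density lborel std_normal_density) {x. K \<le> \<sigma> * x}" for \<sigma> :: real
  interpret N: prob_space "density lborel std_normal_density"
    by (rule prob_space_normal_density) simp
  have p: "p \<sigma> > 0" if "\<sigma> \<in> {1, -1}" for \<sigma>
    using std_normal_tail_pos[OF that, of K] by (simp add: p_def N.emeasure_eq_measure)
  define E where "E n = {\<omega> \<in> space M. \<forall>s\<in>\<rat> \<inter> {0..1}. \<forall>t\<in>\<rat> \<inter> {0..1}.
    \<bar>s - t\<bar> \<le> 1 / real (Suc n) \<longrightarrow> \<bar>B s \<omega> - B t \<omega>\<bar> \<le> e}" for n
  have E: "E n \<in> events" "(\<lambda>n. prob (E n)) \<longlonglongrightarrow> 1" for n
    unfolding E_def using oscillation_tendsto_1[OF \<open>0 < e\<close>] by auto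
  have "\<forall>\<^sub>F n in sequentially. 1 - min (p 1) (p (-1)) < prob (E n)"
    using order_tendstoD(1)[OF E(2)] p by simp
  moreover have "(\<lambda>n. K / real (Suc n)) \<longlonglongrightarrow> 0"
    using LIMSEQ_Suc[OF lim_const_over_n] by simp
  then have "\<forall>\<^sub>F n in sequentially. K / real (Suc n) < e"
    using \<open>0 < e\<close> by (rule order_tendstoD)
  ultimately have "\<forall>\<^sub>F n in sequentially. 1 - min (p 1) (p (-1)) < prob (E n) \<and> K / real (Suc n) < e"
    by (rule eventually_conj)
  then obtain n where n: "1 - min (p 1) (p (-1)) < prob (E n)" "K / real (Suc n) < e"
    by (auto simp: eventually_sequentially)
  show thesis
  proof (rule that[of "Suc n"])
    fix i :: nat and \<sigma> :: real assume i: "i < Suc n" and \<sigma>: "\<sigma> \<in> {1, -1}"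
    define s t where "s = real i / Suc n" and "t = real (Suc i) / Suc n"
    have st: "0 \<le> s" "s < t" "t \<le> 1" "t - s = 1 / Suc n"
      using i by (auto simp: s_def t_def field_simps)
    have [measurable]: "B t \<in> borel_measurable M" "B s \<in> borel_measurable M"
      using st by (auto intro!: random_variable_B)
    define G where "G = {\<omega> \<in> space M. K * (t - s) \<le> \<sigma> * (B t \<omega> - B s \<omega>)}"
    have [measurable]: "G \<in> events" unfolding G_def by measurable
    define Q where "Q = {\<omega> \<in> space M. \<forall>u\<in>{s..t}. \<bar>B u \<omega> - B s \<omega>\<bar> \<le> e}"
    have [measurable]: "Q \<in> events" unfolding Q_def
      using st by (intro sets_path_le)
        (auto intro!: continuous_intros continuous_B borel_measurable_abs borel_measurable_diff random_variable_B)
    have "E n \<subseteq> Q"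
    proof
      fix \<omega> assume \<omega>: "\<omega> \<in> E n"
      have "\<bar>B u \<omega> - B s \<omega>\<bar> \<le> e" if u: "u \<in> {s..t}" for u
      proof (rule continuous_le_on_closure[of "{s<..<t} \<inter> \<rat>" "\<lambda>u. \<bar>B u \<omega> - B s \<omega>\<bar>"])
        have cl: "closure ({s<..<t} \<inter> \<rat>) = {s..t}"
          using closure_open_Int_superset[of "{s<..<t}" "\<rat>"] st by (simp add: Rats_closure_real)
        show "continuous_on (closure ({s<..<t} \<inter> \<rat>)) (\<lambda>u. \<bar>B u \<omega> - B s \<omega>\<bar>)"
          unfolding cl using \<omega> st by (intro continuous_intros continuous_B) (auto simp: E_def)
        show "u \<in> closure ({s<..<t} \<inter> \<rat>)" using u cl by simp
        fix v assume v: "v \<in> {s<..<t} \<inter> \<rat>"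
        moreover have "s \<in> \<rat>" by (simp add: s_def)
        ultimately show "\<bar>B v \<omega> - B s \<omega>\<bar> \<le> e"
          using \<omega> st unfolding E_def by (auto simp: abs_if)
      qed
      with \<omega> show "\<omega> \<in> Q" by (auto simp: Q_def E_def)
    qed
    then have "prob (E n) \<le> prob Q" by (intro finite_measure_mono) auto
    moreover have "p \<sigma> \<le> prob G"
      unfolding G_def p_def using st \<sigma> \<open>0 \<le> K\<close> by (intro increment_tail) auto
    moreover have "prob (G \<union> Q) = prob G + prob Q - prob (G \<inter> Q)"
      by (rule measure_Un3) (auto simp: fmeasurable_eq_sets)
    moreover have "prob (G \<union> Q) \<le> 1" by simp
    ultimately have "prob (G \<inter> Q) > 0" using n \<sigma> by auto
    also have "G \<inter> Q = {\<omega> \<in> space M. K / Suc n \<le> \<sigma> * (B (Suc i / Suc n) \<omega> - B (i / Suc n) \<omega>) \<and>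
        (\<forall>u\<in>{i / Suc n..Suc i / Suc n}. \<bar>B u \<omega> - B (i / Suc n) \<omega>\<bar> \<le> e)}"
      using st(4) unfolding s_def[symmetric] t_def[symmetric] by (auto simp: G_def Q_def)
    finally show "prob {\<omega> \<in> space M. K / Suc n \<le> \<sigma> * (B (Suc i / Suc n) \<omega> - B (i / Suc n) \<omega>) \<and>
        (\<forall>u\<in>{i / Suc n..Suc i / Suc n}. \<bar>B u \<omega> - B (i / Suc n) \<omega>\<bar> \<le> e)} > 0" .
  qed (use n in auto)
qed

text \<open>The path is steered along a grid of mesh \<open>1 / n\<close>: wherever it is below \<open>\<phi>\<close> at a grid point, the next step
has to go up by at least \<open>K / n\<close>, and otherwise down by at least \<open>K / n\<close>. As \<open>\<phi>\<close> changes by at most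
\<open>K / n\<close> in one step, the distance to \<open>\<phi>\<close> is pulled back towards \<open>0\<close> and stays bounded. Each step is
independent of the past and possible, so finitely many of them are jointly possible.\<close>

lemma support_theorem:
  assumes lip: "\<And>s t. s \<in> {0..1} \<Longrightarrow> t \<in> {0..1} \<Longrightarrow> \<bar>\<phi> s - \<phi> t\<bar> \<le> K * \<bar>s - t\<bar>"
    and \<phi>0: "\<phi> 0 = 0" and e: "0 < e"
  shows "prob {\<omega> \<in> space M. \<forall>t\<in>{0..1}. \<bar>B t \<omega> - \<phi> t\<bar> \<le> e} > 0"
proof -
  \<comment> \<open>At grid points the distance stays below \<open>2 * d\<close>; between them it grows by at most \<open>d\<close> through the path and \<open>d\<close> through \<open>\<phi>\<close>.\<close>
  define d where "d = e / 4"
  have d: "0 < d" using e by (simp add: d_def)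
  have K: "0 \<le> K" using lip[of 0 1] by simp
  have cont: "continuous_on {0..1} \<phi>"
    using lip K by (intro lipschitz_on_continuous_on[of K] lipschitz_onI) (auto simp: dist_real_def)
  from steps_possible[OF K d] obtain n where n: "n > 0" "K / real n \<le> d"
    and step: "\<And>i \<sigma>. i < n \<Longrightarrow> \<sigma> \<in> {1, -1} \<Longrightarrow>
      prob {\<omega> \<in> space M. K / n \<le> \<sigma> * (B (Suc i / n) \<omega> - B (i / n) \<omega>) \<and>
        (\<forall>u\<in>{i / n..Suc i / n}. \<bar>B u \<omega> - B (i / n) \<omega>\<bar> \<le> d)} > 0"
    by blast
  define G where "G i = {\<omega> \<in> space M. (\<forall>t\<in>{0..i / n}. \<bar>B t \<omega> - \<phi> t\<bar> \<le> 4 * d) \<and>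
    \<bar>B (i / n) \<omega> - \<phi> (i / n)\<bar> \<le> 2 * d}" for i :: nat
  have "prob (G i) > 0" if "i \<le> n" for i
    using that
  proof (induction i)
    case 0
    have "G 0 = space M" using start_zero \<phi>0 d by (auto simp: G_def)
    then show ?case by (simp add: prob_space)
  next
    case (Suc i)
    define s t where "s = real i / n" and "t = real (Suc i) / n"
    have st: "0 \<le> s" "s < t" "t \<le> 1" "t - s = 1 / n"
      using n Suc.prems by (auto simp: s_def t_def field_simps)
    define P where "P = increments_over {0..s}"
    have B_P: "B u \<in> borel_measurable P" if "u \<in> {0..s}" for u
      unfolding P_def using that st by (intro measurable_B) auto
    have sP: "space P = space M" by (simp add: P_def)
    have [measurable]: "B s \<in> borel_measurable P" using st by (intro B_P) auto
    have tube: "{\<omega> \<in> space P. \<forall>u\<in>{0..s}. \<bar>B u \<omega> - \<phi> u\<bar> \<le> 4 * d} \<in> sets P"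
      using st by (intro sets_path_le)
        (auto simp: sP intro!: continuous_intros continuous_B B_P continuous_on_subset[OF cont] borel_measurable_abs borel_measurable_diff)
    have "G i = {\<omega> \<in> space P. \<forall>u\<in>{0..s}. \<bar>B u \<omega> - \<phi> u\<bar> \<le> 4 * d} \<inter>
        {\<omega> \<in> space P. \<bar>B s \<omega> - \<phi> s\<bar> \<le> 2 * d}"
      by (auto simp: G_def s_def sP)
    also have "\<dots> \<in> sets P" by (intro sets.Int tube) measurable
    finally have G[measurable]: "G i \<in> sets P" .
    \<comment> \<open>Paths that have to be steered up (\<open>\<sigma> = 1\<close>) or down (\<open>\<sigma> = - 1\<close>) in the next step.\<close>
    define H where "H \<sigma> = {\<omega> \<in> G i. (\<sigma> = 1) = (B s \<omega> < \<phi> s)}" for \<sigma> :: real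
    have H: "H \<sigma> \<in> sets P" for \<sigma> unfolding H_def by measurable
    define U where "U \<sigma> = {\<omega> \<in> space M. K / n \<le> \<sigma> * (B t \<omega> - B s \<omega>) \<and>
      (\<forall>u\<in>{s..t}. \<bar>B u \<omega> - B s \<omega>\<bar> \<le> d)}" for \<sigma>
    define F where "F = increments_over {s..t}"
    have sF: "space F = space M" by (simp add: F_def)
    have B_F: "(\<lambda>\<omega>. B u \<omega> - B s \<omega>) \<in> borel_measurable F" if "u \<in> {s..t}" for u
      unfolding F_def using that st by (intro measurable_increment) auto
    have [measurable]: "(\<lambda>\<omega>. B t \<omega> - B s \<omega>) \<in> borel_measurable F" using st by (intro B_F) auto
    have tube: "{\<omega> \<in> space F. \<forall>u\<in>{s..t}. \<bar>B u \<omega> - B s \<omega>\<bar> \<le> d} \<in> sets F"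
      using st by (intro sets_path_le)
        (auto simp: sF intro!: continuous_intros continuous_B B_F borel_measurable_abs)
    have U: "U \<sigma> \<in> sets F" for \<sigma>
    proof -
      have "U \<sigma> = {\<omega> \<in> space F. \<forall>u\<in>{s..t}. \<bar>B u \<omega> - B s \<omega>\<bar> \<le> d} \<inter>
          {\<omega> \<in> space F. K / n \<le> \<sigma> * (B t \<omega> - B s \<omega>)}"
        by (auto simp: U_def sF)
      also have "\<dots> \<in> sets F" by (intro sets.Int tube) measurable
      finally show ?thesis .
    qed
    have U_pos: "prob (U \<sigma>) > 0" if "\<sigma> \<in> {1, -1}" for \<sigma>
      using step[of i \<sigma>] that Suc.prems by (simp add: U_def s_def t_def)
    have events: "X \<in> events" if "X \<in> sets P \<or> X \<in> sets F" for X
      using that increments_over_subset by (auto simp: P_def F_def)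
    have "G i = H 1 \<union> H (-1)" by (auto simp: H_def)
    then have "prob (G i) \<le> prob (H 1) + prob (H (-1))"
      using events H by (simp add: measure_Un_le)
    with Suc have "prob (H 1) > 0 \<or> prob (H (-1)) > 0" by linarith
    then obtain \<sigma> where \<sigma>: "\<sigma> \<in> {1, -1}" "prob (H \<sigma>) > 0" by blast
    have "finite ({0..s} \<inter> {s..t})" by (rule finite_subset[of _ "{s}"]) auto
    then have "prob (H \<sigma> \<inter> U \<sigma>) = prob (H \<sigma>) * prob (U \<sigma>)"
      using H[of \<sigma>] U[of \<sigma>] unfolding P_def F_def by (rule prob_indep_increments_over)
    with \<sigma> U_pos have "prob (H \<sigma> \<inter> U \<sigma>) > 0" by simp
    also have "prob (H \<sigma> \<inter> U \<sigma>) \<le> prob (G (Suc i))"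
    proof (rule finite_measure_mono)
      show "H \<sigma> \<inter> U \<sigma> \<subseteq> G (Suc i)"
      proof
        fix \<omega> assume \<omega>: "\<omega> \<in> H \<sigma> \<inter> U \<sigma>"
        have phi: "\<bar>\<phi> u - \<phi> s\<bar> \<le> K / n" if "u \<in> {s..t}" for u
        proof -
          have "\<bar>\<phi> u - \<phi> s\<bar> \<le> K * \<bar>u - s\<bar>" using that st by (intro lip) auto
          also have "\<dots> \<le> K * (1 / n)" using that st K by (intro mult_left_mono) auto
          finally show ?thesis by simp
        qed
        have s: "\<bar>B s \<omega> - \<phi> s\<bar> \<le> 2 * d" "(\<sigma> = 1) = (B s \<omega> < \<phi> s)" and w: "\<omega> \<in> space M"
          and past: "\<forall>u\<in>{0..s}. \<bar>B u \<omega> - \<phi> u\<bar> \<le> 4 * d"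
          and u: "\<And>u. u \<in> {s..t} \<Longrightarrow> \<bar>B u \<omega> - B s \<omega>\<bar> \<le> d"
          and inc: "K / n \<le> \<sigma> * (B t \<omega> - B s \<omega>)"
          using \<omega> by (auto simp: H_def G_def U_def s_def)
        have "\<bar>B v \<omega> - \<phi> v\<bar> \<le> 4 * d" if "v \<in> {0..t}" for v
        proof (cases "v \<le> s")
          case False
          then show ?thesis using u[of v] phi[of v] s(1) that n(2) by auto
        qed (use past that in auto)
        moreover have "\<bar>B t \<omega> - \<phi> t\<bar> \<le> 2 * d"
          using u[of t] phi[of t] s inc \<sigma>(1) n(2) st by auto
        ultimately show "\<omega> \<in> G (Suc i)" using w by (simp add: G_def t_def)
      qed
      have *: "{\<omega> \<in> space M. \<forall>u\<in>{0..t}. \<bar>B u \<omega> - \<phi> u\<bar> \<le> 4 * d} \<in> events"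
        using st by (intro sets_path_le)
          (auto intro!: continuous_intros continuous_B random_variable_B continuous_on_subset[OF cont] borel_measurable_abs borel_measurable_diff)
      have [measurable]: "B t \<in> borel_measurable M" using st by (intro random_variable_B) auto
      have "G (Suc i) = {\<omega> \<in> space M. \<forall>u\<in>{0..t}. \<bar>B u \<omega> - \<phi> u\<bar> \<le> 4 * d} \<inter>
        {\<omega> \<in> space M. \<bar>B t \<omega> - \<phi> t\<bar> \<le> 2 * d}"
        by (auto simp: G_def t_def)
      also have "\<dots> \<in> events" by (intro sets.Int *) measurable
      finally show "G (Suc i) \<in> events" .
    qed
    finally show ?case .
  qed
  from this[of n] have "prob (G n) > 0" by simp
  also have "prob (G n) \<le> prob {\<omega> \<in> space M. \<forall>t\<in>{0..1}. \<bar>B t \<omega> - \<phi> t\<bar> \<le> e}"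
  proof (rule finite_measure_mono)
    show "{\<omega> \<in> space M. \<forall>t\<in>{0..1}. \<bar>B t \<omega> - \<phi> t\<bar> \<le> e} \<in> events"
      by (intro sets_path_le)
        (auto intro!: continuous_intros continuous_B random_variable_B cont borel_measurable_abs borel_measurable_diff)
  qed (use n in \<open>auto simp: G_def d_def\<close>)
  finally show ?thesis .
qed

end

section \<open>Sums with an independent normal variable\<close>

lemma AE_lborel_translate:
  fixes C :: "real set"
  assumes [measurable]: "C \<in> sets borel"
  shows "(AE x in lborel. x + z \<notin> C) \<longleftrightarrow> (AE x in lborel. x \<notin> C)"
proof -
  have "(AE x in lborel. x \<notin> C) \<longleftrightarrow> (AE x in distr lborel borel ((+) z). x \<notin> C)"
    unfolding lborel_distr_plus ..
  also have "\<dots> \<longleftrightarrow> (AE x in lborel. z + x \<notin> C)" by (subst AE_distr_iff) auto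
  finally show ?thesis by (simp add: add.commute)
qed

context prob_space
begin

lemma AE_normal_translate:
  fixes C :: "real set"
  assumes b: "distributed M lborel b (normal_density 0 \<sigma>)" "0 < \<sigma>" and [measurable]: "C \<in> sets borel"
  shows "(AE x in distr M borel b. x + z \<notin> C) \<longleftrightarrow> (AE x in lborel. x \<notin> C)"
proof -
  have "distr M borel b = density lborel (normal_density 0 \<sigma>)"
    using distributed_distr_eq_density[OF b(1)] by (metis distr_cong sets_lborel)
  then have "(AE x in distr M borel b. x + z \<notin> C) \<longleftrightarrow> (AE x in lborel. x + z \<notin> C)"
    unfolding \<open>distr M borel b = _\<close> using normal_density_pos[OF b(2)] by (subst AE_density) auto
  then show ?thesis by (simp add: AE_lborel_translate)
qed

text \<open>Fubini for independent \<sigma>-algebras: the joint law of \<open>Y\<close> and \<open>X\<close> is the product of their laws.\<close>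

lemma AE_indep_iff:
  assumes indep: "indep_set (sets F) (sets G)" and sp: "space F = space M" "space G = space M"
    and Y: "Y \<in> measurable F T" and X: "X \<in> measurable G S"
    and [measurable]: "Measurable.pred (T \<Otimes>\<^sub>M S) (\<lambda>p. P (fst p) (snd p))"
  shows "(AE \<omega> in M. P (Y \<omega>) (X \<omega>)) \<longleftrightarrow> (AE y in distr M T Y. AE x in distr M S X. P y x)"
proof -
  have [measurable]: "Y \<in> measurable M T" "X \<in> measurable M S"
    using indep_setD_ev1[OF indep] indep_setD_ev2[OF indep] sp Y X by (auto simp: measurable_def)
  interpret Y: prob_space "distr M T Y" by (rule prob_space_distr) measurable
  interpret X: prob_space "distr M S X" by (rule prob_space_distr) measurable
  interpret pair_sigma_finite "distr M T Y" "distr M S X" ..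
  have eq: "distr M T Y \<Otimes>\<^sub>M distr M S X = distr M (T \<Otimes>\<^sub>M S) (\<lambda>\<omega>. (Y \<omega>, X \<omega>))"
  proof (rule pair_measure_eqI)
    fix A A' assume "A \<in> sets (distr M T Y)" "A' \<in> sets (distr M S X)"
    then have [measurable]: "A \<in> sets T" "A' \<in> sets S" by auto
    have "Y -` A \<inter> space M \<in> sets F" "X -` A' \<inter> space M \<in> sets G"
      using measurable_sets[OF Y] measurable_sets[OF X] sp by auto
    then have "prob ((Y -` A \<inter> space M) \<inter> (X -` A' \<inter> space M)) =
        prob (Y -` A \<inter> space M) * prob (X -` A' \<inter> space M)"
      by (rule indep_setD[OF indep])
    moreover have "(\<lambda>\<omega>. (Y \<omega>, X \<omega>)) -` (A \<times> A') \<inter> space M = (Y -` A \<inter> space M) \<inter> (X -` A' \<inter> space M)"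
      by auto
    ultimately show "emeasure (distr M T Y) A * emeasure (distr M S X) A' =
        emeasure (distr M (T \<Otimes>\<^sub>M S) (\<lambda>\<omega>. (Y \<omega>, X \<omega>))) (A \<times> A')"
      by (simp add: emeasure_distr emeasure_eq_measure ennreal_mult)
  qed (auto intro: X.sigma_finite_measure_axioms Y.sigma_finite_measure_axioms)
  have "(AE y in distr M T Y. AE x in distr M S X. P y x) \<longleftrightarrow>
      (AE p in distr M T Y \<Otimes>\<^sub>M distr M S X. P (fst p) (snd p))"
  proof (rule AE_pair_iff)
    have "{p \<in> space (T \<Otimes>\<^sub>M S). P (fst p) (snd p)} \<in> sets (T \<Otimes>\<^sub>M S)" by measurable
    moreover have sets: "sets (distr M T Y \<Otimes>\<^sub>M distr M S X) = sets (T \<Otimes>\<^sub>M S)"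
      by (intro sets_pair_measure_cong) auto
    ultimately show "{p \<in> space (distr M T Y \<Otimes>\<^sub>M distr M S X). P (fst p) (snd p)}
        \<in> sets (distr M T Y \<Otimes>\<^sub>M distr M S X)"
      by (simp only: sets sets_eq_imp_space_eq[OF sets])
  qed
  also have "\<dots> \<longleftrightarrow> (AE \<omega> in M. P (Y \<omega>) (X \<omega>))"
    unfolding eq by (subst AE_distr_iff) auto
  finally show ?thesis by simp
qed

text \<open>Conditionally on \<open>F\<close>, the variable \<open>b + Z\<close> has a translated normal law, whose null sets are those of
Lebesgue measure. So null sets are avoided, and conversely a set that is avoided on an event of
positive probability is null.\<close>
lemma
  fixes C :: "real set"
  assumes b: "distributed M lborel b (normal_density 0 \<sigma>)" "0 < \<sigma>" and [measurable]: "C \<in> sets borel"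
    and indep: "indep_set (sets F) (sets G)" and sp: "space F = space M" "space G = space M"
    and bG: "b \<in> borel_measurable G" and Z: "Z \<in> borel_measurable F"
  shows indep_normal_sum_notin_null:
      "(AE x in lborel. x \<notin> C) \<Longrightarrow> AE \<omega> in M. b \<omega> + Z \<omega> \<notin> C"
    and indep_normal_sum_notin_imp_null:
      "D \<in> sets F \<Longrightarrow> 0 < prob D \<Longrightarrow> (AE \<omega> in M. \<omega> \<in> D \<longrightarrow> b \<omega> + Z \<omega> \<notin> C) \<Longrightarrow>
       AE x in lborel. x \<notin> C"
proof -
  assume "AE x in lborel. x \<notin> C"
  then show "AE \<omega> in M. b \<omega> + Z \<omega> \<notin> C"
    using AE_indep_iff[OF indep sp Z bG, of "\<lambda>z x. x + z \<notin> C"] AE_normal_translate[OF b] by simp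
next
  assume D: "D \<in> sets F" "0 < prob D" and ae: "AE \<omega> in M. \<omega> \<in> D \<longrightarrow> b \<omega> + Z \<omega> \<notin> C"
  \<comment> \<open>The indicator is carried along in order to condition on \<open>Z\<close> and \<open>D\<close> simultaneously.\<close>
  define Y where "Y \<omega> = (Z \<omega>, indicator D \<omega> :: real)" for \<omega>
  have Y: "Y \<in> measurable F (borel \<Otimes>\<^sub>M borel)" unfolding Y_def using Z D by measurable
  have YM: "Y \<in> measurable M (borel \<Otimes>\<^sub>M borel)"
    using indep_setD_ev1[OF indep] sp Y by (auto simp: measurable_def)
  have "AE \<omega> in M. snd (Y \<omega>) = 1 \<longrightarrow> b \<omega> + fst (Y \<omega>) \<notin> C"
    using ae by eventually_elim (auto simp: Y_def indicator_def)
  then have "AE y in distr M (borel \<Otimes>\<^sub>M borel) Y. AE x in distr M borel b. snd y = 1 \<longrightarrow> x + fst y \<notin> C"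
    by (subst AE_indep_iff[OF indep sp Y bG, of "\<lambda>y x. snd y = 1 \<longrightarrow> x + fst y \<notin> C", symmetric]) simp_all
  from AE_distrD[OF YM this] have "AE \<omega> in M. \<omega> \<in> D \<longrightarrow> (AE x in lborel. x \<notin> C)"
    by eventually_elim (auto simp: Y_def AE_normal_translate[OF b])
  moreover have "\<not> (AE \<omega> in M. \<omega> \<notin> D)"
    using D indep_setD_ev1[OF indep]
    by (subst AE_iff_measurable[of D]) (auto simp: emeasure_eq_measure dest: sets.sets_into_space)
  ultimately show "AE x in lborel. x \<notin> C" by (cases "AE x in lborel. x \<notin> C") auto
qed

end

section \<open>Paths whose minimum lies in a late valley\<close>

lemma measurable_first_argmin:
  fixes X :: "real \<Rightarrow> 'a \<Rightarrow> real"
  assumes X: "\<And>t. t \<in> {0..1} \<Longrightarrow> X t \<in> borel_measurable N"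
    and cont: "\<And>\<omega>. \<omega> \<in> space N \<Longrightarrow> continuous_on {0..1} (\<lambda>t. X t \<omega>)"
  shows "(\<lambda>\<omega>. first_argmin (\<lambda>t. X t \<omega>)) \<in> borel_measurable N"
proof (rule borel_measurableI_le)
  fix s :: real
  note range = first_argmin(1)[OF cont]
  consider "s < 0" | "1 < s" | "s \<in> {0..1}" by force
  then show "{\<omega> \<in> space N. first_argmin (\<lambda>t. X t \<omega>) \<le> s} \<in> sets N"
  proof cases
    case 1
    then have "{\<omega> \<in> space N. first_argmin (\<lambda>t. X t \<omega>) \<le> s} = {}" using range by force
    then show ?thesis by (simp only: sets.empty_sets)
  next
    case 2
    then have "{\<omega> \<in> space N. first_argmin (\<lambda>t. X t \<omega>) \<le> s} = space N" using range by force
    then show ?thesis by (simp only: sets.top)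
  next
    case 3
    have "{\<omega> \<in> space N. \<forall>q\<in>\<rat> \<inter> {0..1}. \<forall>n::nat. \<exists>p\<in>\<rat> \<inter> {0..s}. X p \<omega> < X q \<omega> + 1 / Suc n} \<in> sets N"
    proof (intro sets.sets_Collect_countable_All' sets.sets_Collect_countable_All
        sets.sets_Collect_countable_Ex')
      fix p q :: real and n :: nat assume "q \<in> \<rat> \<inter> {0..1}" "p \<in> \<rat> \<inter> {0..s}"
      with 3 have [measurable]: "X p \<in> borel_measurable N" "X q \<in> borel_measurable N" by (auto intro!: X)
      show "{\<omega> \<in> space N. X p \<omega> < X q \<omega> + 1 / Suc n} \<in> sets N" by measurable
    qed (auto simp: countable_rat)
    then show ?thesis using first_argmin_le_iff[OF cont 3] by (simp cong: conj_cong)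
  qed
qed

text \<open>The profile of the valley after time \<open>1/2\<close>. It starts at \<open>0\<close>, has its bottom \<open>-6\<close> at time \<open>4/5\<close> and
is so steep that an error of \<open>1/4\<close> in height moves the argmin by at most \<open>1/40\<close>.\<close>

definition well :: "real \<Rightarrow> real" where
  "well t = 20 * \<bar>t - 4/5\<bar> - 6"

definition valley :: "(real \<Rightarrow> real) \<Rightarrow> bool" where
  "valley f \<longleftrightarrow> (\<forall>t\<in>{1/2..1}. \<bar>f t - f (1/2) - well t\<bar> \<le> 1/4)"

lemma well_simps[simp]: "well (1/2) = 0" "well (4/5) = - 6" "well 1 = - 2"
  by (simp_all add: well_def)

lemma
  shows well_ge: "- 6 \<le> well t"
    and well_nonpos: "t \<in> {1/2..1} \<Longrightarrow> well t \<le> 0"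
    and well_nonneg: "t \<in> {0..1/2} \<Longrightarrow> 0 \<le> well t"
    and well_deep: "well t \<le> - 11/2 \<Longrightarrow> \<bar>t - 4/5\<bar> \<le> 1/40"
    and well_lipschitz: "\<bar>well s - well t\<bar> \<le> 20 * \<bar>s - t\<bar>"
  by (auto simp: well_def abs_if split: if_splits)

lemma continuous_on_well[continuous_intros]: "continuous_on S well"
  unfolding well_def by (intro continuous_intros)

lemma lipschitz_add_well:
  assumes "\<bar>h s - h t\<bar> \<le> K * \<bar>s - t\<bar>"
  shows "\<bar>(h s + min 0 (well s)) - (h t + min 0 (well t))\<bar> \<le> (K + 20) * \<bar>s - t\<bar>"
proof -
  have "\<bar>min 0 (well s) - min 0 (well t)\<bar> \<le> \<bar>well s - well t\<bar>" by (auto simp: min_def)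
  also note well_lipschitz
  finally show ?thesis
    using assms by (intro order_trans[OF abs_diff_triangle_ineq]) (simp add: distrib_right add_mono)
qed

lemma valley_bounds:
  assumes "valley f" "t \<in> {1/2..1}"
  shows "f (1/2) + well t - 1/4 \<le> f t" "f t \<le> f (1/2) + well t + 1/4"
proof -
  have a: "\<bar>f t - f (1/2) - well t\<bar> \<le> 1/4" using assms by (simp add: valley_def)
  show "f (1/2) + well t - 1/4 \<le> f t" "f t \<le> f (1/2) + well t + 1/4"
    using abs_le_D1[OF a] abs_le_D2[OF a] by linarith+
qed

lemma valleyI:
  assumes tube: "\<And>t. t \<in> {1/2..1} \<Longrightarrow> \<bar>f t - (c + min 0 (well t))\<bar> \<le> 1/8"
  shows "valley f"
  unfolding valley_def
proof
  fix t :: real assume t: "t \<in> {1/2..1}"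
  have a: "\<bar>f t - (c + well t)\<bar> \<le> 1/8" using tube[OF t] well_nonpos[OF t] by (simp add: min_absorb2)
  have b: "\<bar>f (1/2) - c\<bar> \<le> 1/8" using tube[of "1/2"] by simp
  show "\<bar>f t - f (1/2) - well t\<bar> \<le> 1/4"
    using abs_le_D1[OF a] abs_le_D2[OF a] abs_le_D1[OF b] abs_le_D2[OF b] by (intro abs_leI) linarith+
qed

text \<open>The first argmin on \<open>{1/2..1}\<close>, moved to the unit interval where \<open>first_argmin\<close> operates. Clipping to
\<open>{3/4..17/20}\<close> changes nothing for a valley, and keeps \<open>late_argmin f - 9/20\<close> inside \<open>{3/10..2/5}\<close>
for every path.\<close>

definition late_argmin :: "(real \<Rightarrow> real) \<Rightarrow> real" where
  "late_argmin f = max (3/4) (min (17/20) (1/2 + first_argmin (\<lambda>u. f (1/2 + u/2) - f (1/2)) / 2))"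

text \<open>The Vervaat transform at time \<open>11/20\<close>, provided that the global first argmin is \<open>late_argmin f\<close>.\<close>

definition rotated_value :: "(real \<Rightarrow> real) \<Rightarrow> real" where
  "rotated_value f = f (late_argmin f - 9/20) + (f 1 - f (late_argmin f))"

lemma late_argmin_range: "3/4 \<le> late_argmin f" "late_argmin f \<le> 17/20"
  unfolding late_argmin_def by (rule max.cobounded1) (rule max.boundedI, simp, rule min.cobounded1)

text \<open>The bottom of the valley is at most \<open>f (1/2) - 23/4\<close>, hence below all earlier values, and heights that low
only occur within \<open>1/40\<close> of time \<open>4/5\<close>.\<close>

lemma first_argmin_eq_late_argmin:
  assumes f: "continuous_on {0..1} f" and v: "valley f"
    and early: "\<And>t. t \<in> {0..1/2} \<Longrightarrow> f (1/2) - 11/2 \<le> f t"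
  shows "first_argmin f = late_argmin f"
proof -
  define g where "g u = f (1/2 + u/2) - f (1/2)" for u
  define m where "m = 1/2 + first_argmin g / 2"
  have g: "continuous_on {0..1} g"
    unfolding g_def by (intro continuous_intros continuous_on_compose2[OF f]) auto
  have m: "m \<in> {1/2..1}" using first_argmin(1)[OF g] by (auto simp: m_def)
  have fm: "f m \<le> f t" if "t \<in> {1/2..1}" for t
    using first_argmin(2)[OF g, of "2 * t - 1"] that by (auto simp: g_def m_def diff_divide_distrib)
  have f8: "f m \<le> f (1/2) - 23/4" using valley_bounds(2)[OF v, of "4/5"] fm[of "4/5"] by simp
  have near: "\<bar>m - 4/5\<bar> \<le> 1/40" using f8 valley_bounds(1)[OF v m] by (intro well_deep) simp
  then have "3/4 \<le> m" "m \<le> 17/20" using abs_le_D1[OF near] abs_le_D2[OF near] by linarith+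
  moreover have "late_argmin f = max (3/4) (min (17/20) m)"
    by (simp add: late_argmin_def m_def g_def[abs_def])
  ultimately have late: "late_argmin f = m" by simp
  have less: "f m < f t" if "t \<in> {0..1/2}" for t using early[OF that] f8 by linarith
  have glob: "f m \<le> f t" if "t \<in> {0..1}" for t
    using fm[of t] less[of t] that by (cases "t \<le> 1/2") auto
  define a where "a = first_argmin f"
  have a: "a \<in> {0..1}" using first_argmin(1)[OF f] by (simp add: a_def)
  have am: "a \<le> m" unfolding a_def using m glob by (intro first_argmin(3)[OF f]) auto
  have fa: "f a \<le> f t" if "t \<in> {0..1}" for t unfolding a_def using that by (rule first_argmin(2)[OF f])
  have "f a \<le> f m" using fa[of m] m by auto
  then have a2: "1/2 < a" using less[of a] a by (cases "a \<le> 1/2") auto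
  have "first_argmin g \<le> 2 * a - 1"
    using a a2 fa by (intro first_argmin(3)[OF g]) (auto simp: g_def diff_divide_distrib)
  then have "m \<le> a" by (simp add: m_def)
  with am late show ?thesis by (simp add: a_def)
qed

lemma frac_eqI: "x - a \<in> \<int> \<Longrightarrow> 0 \<le> a \<Longrightarrow> a < 1 \<Longrightarrow> frac x = a" for x a :: real
  by (simp add: frac_unique_iff)

lemma vervaat_after_wrap:
  assumes "first_argmin f = a" "1 \<le> a + t" "a + t < 2"
  shows "vervaat f t = f (a + t - 1) + f 1 - f a"
proof -
  have "frac (a + t) = a + t - 1" using assms by (intro frac_eqI) auto
  then show ?thesis using assms by (simp add: vervaat_def add.commute)
qed

lemma vervaat_before_wrap:
  assumes "first_argmin f = a" "0 \<le> a + t" "a + t < 1"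
  shows "vervaat f t = f (a + t) - f a"
proof -
  have "frac (a + t) = a + t" using assms by (intro frac_eqI) auto
  then show ?thesis using assms by (simp add: vervaat_def add.commute)
qed

text \<open>A negative value can only occur after the rotation has wrapped around; from then on the path shows
\<open>f\<close> on its way to the minimum, which is attained at the end. If the first argmin is \<open>1\<close>, the
transform ends at \<open>f 0 = 0\<close> instead of \<open>f 1\<close>.\<close>

lemma vervaat_end_le_0:
  assumes f: "continuous_on {0..1} f" "f 0 = 0" and r: "0 \<le> r" "r < 1" and neg: "vervaat f r < 0"
  shows "vervaat f 1 \<le> 0"
proof -
  define a where "a = first_argmin f"
  have a: "0 \<le> a" "a \<le> 1" using first_argmin(1)[OF f(1)] by (auto simp: a_def)
  have fa: "f a \<le> f t" if "0 \<le> t" "t \<le> 1" for t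
    unfolding a_def using that by (intro first_argmin(2)[OF f(1)]) auto
  have wrap: "1 \<le> a + r"
  proof (rule ccontr)
    assume "\<not> 1 \<le> a + r"
    then have "vervaat f r = f (a + r) - f a" using a r by (intro vervaat_before_wrap) (auto simp: a_def)
    with neg fa[of "a + r"] a r \<open>\<not> 1 \<le> a + r\<close> show False by auto
  qed
  show ?thesis
  proof (cases "a = 1")
    case True
    have frac2: "frac (2 :: real) = 0" by (intro frac_eqI) auto
    have "first_argmin f = 1" using True by (simp add: a_def)
    then show ?thesis by (simp add: vervaat_def frac2 f(2))
  next
    case False
    have "vervaat f r = f (a + r - 1) + f 1 - f a"
      using wrap a r by (intro vervaat_after_wrap) (auto simp: a_def)
    moreover have "f a \<le> f (a + r - 1)" using wrap a r by (intro fa) auto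
    moreover have "vervaat f 1 = f (a + 1 - 1) + f 1 - f a"
      using a False by (intro vervaat_after_wrap) (auto simp: a_def)
    ultimately show ?thesis using neg by simp
  qed
qed

text \<open>For an argmin in \<open>{3/4..17/20}\<close>, time \<open>7/20\<close> of the transform corresponds to a time of \<open>f\<close> in
\<open>{1/10..1/5}\<close>. The valley climbs by at most \<open>9/2\<close> after its bottom, which is less than the depth \<open>5\<close>
of the dip.\<close>
lemma
  assumes f: "continuous_on {0..1} f" and v: "valley f"
    and early: "\<And>t. t \<in> {0..1/2} \<Longrightarrow> f (1/2) - 11/2 \<le> f t"
  shows vervaat_valley: "vervaat f (11/20) = rotated_value f"
    and vervaat_valley_end: "vervaat f 1 = f 1"
    and vervaat_valley_neg: "(\<And>t. t \<in> {1/10..1/5} \<Longrightarrow> f t \<le> -5) \<Longrightarrow> vervaat f (7/20) < 0"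
proof -
  note a = first_argmin_eq_late_argmin[OF assms] and range = late_argmin_range[of f]
  show "vervaat f (11/20) = rotated_value f"
    using vervaat_after_wrap[OF a, of "11/20"] range
    by (simp add: rotated_value_def algebra_simps)
  show "vervaat f 1 = f 1"
    using vervaat_after_wrap[OF a, of 1] range by simp
  assume low: "\<And>t. t \<in> {1/10..1/5} \<Longrightarrow> f t \<le> -5"
  have "f 1 - f (late_argmin f) \<le> 9/2"
  proof -
    have "f 1 \<le> f (1/2) - 7/4" using valley_bounds(2)[OF v, of 1] by simp
    moreover have "f (1/2) + well (late_argmin f) - 1/4 \<le> f (late_argmin f)"
      using range by (intro valley_bounds(1)[OF v]) auto
    ultimately show ?thesis using well_ge[of "late_argmin f"] by linarith
  qed
  moreover have "f (late_argmin f + 7/20 - 1) \<le> -5" using range by (intro low) auto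
  moreover have "vervaat f (7/20) = f (late_argmin f + 7/20 - 1) + f 1 - f (late_argmin f)"
    using range by (intro vervaat_after_wrap[OF a]) auto
  ultimately show "vervaat f (7/20) < 0" by linarith
qed

section \<open>Independence properties of the rotated value\<close>

context standard_brownian_motion
begin

lemma support_theorem_subset:
  assumes "\<And>s t. s \<in> {0..1} \<Longrightarrow> t \<in> {0..1} \<Longrightarrow> \<bar>\<phi> s - \<phi> t\<bar> \<le> K * \<bar>s - t\<bar>" "\<phi> 0 = 0" "0 < e"
    and A: "A \<in> events"
    and sub: "\<And>\<omega>. \<omega> \<in> space M \<Longrightarrow> (\<And>t. t \<in> {0..1} \<Longrightarrow> \<bar>B t \<omega> - \<phi> t\<bar> \<le> e) \<Longrightarrow> \<omega> \<in> A"
  shows "prob A > 0"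
proof -
  note support_theorem[OF assms(1-3)]
  also have "prob {\<omega> \<in> space M. \<forall>t\<in>{0..1}. \<bar>B t \<omega> - \<phi> t\<bar> \<le> e} \<le> prob A"
    using A sub by (intro finite_measure_mono) auto
  finally show ?thesis .
qed

lemma measurable_increment_at_random_time:
  assumes cd: "0 \<le> c" "c \<le> d" "d \<le> 1" "{c..d} \<subseteq> S"
    and \<sigma>: "\<sigma> \<in> borel_measurable (increments_over S)"
    and range: "\<And>\<omega>. \<sigma> \<omega> \<in> {c..d}"
  shows "(\<lambda>\<omega>. B (\<sigma> \<omega>) \<omega> - B c \<omega>) \<in> borel_measurable (increments_over S)"
proof -
  define X where "X t \<omega> = B (max c (min d t)) \<omega> - B c \<omega>" for t \<omega>
  have "(\<lambda>\<omega>. X (\<sigma> \<omega>) \<omega>) \<in> borel_measurable (increments_over S)"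
  proof (rule measurable_at_random_time[where X = X and \<sigma> = \<sigma>])
    show "X t \<in> borel_measurable (increments_over S)" for t
      unfolding X_def using cd by (intro measurable_increment) (auto simp: max_def min_def split: if_splits)
    show "continuous_on {0..1} (\<lambda>t. X t \<omega>)" if "\<omega> \<in> space (increments_over S)" for \<omega>
      unfolding X_def using that cd
      by (intro continuous_intros continuous_on_compose2[OF continuous_paths]) auto
    show "\<sigma> \<omega> \<in> {0..1}" for \<omega> using range[of \<omega>] cd by auto
  qed fact
  moreover have "max c (min d (\<sigma> \<omega>)) = \<sigma> \<omega>" for \<omega> using range[of \<omega>] by auto
  ultimately show ?thesis by (simp add: X_def)
qed

lemma measurable_late_argmin:
  assumes "{1/2..1} \<subseteq> S"
  shows "(\<lambda>\<omega>. late_argmin (\<lambda>t. B t \<omega>)) \<in> borel_measurable (increments_over S)"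
proof -
  have [measurable]: "(\<lambda>\<omega>. first_argmin (\<lambda>u. B (1/2 + u/2) \<omega> - B (1/2) \<omega>)) \<in> borel_measurable (increments_over S)"
  proof (rule measurable_first_argmin)
    fix u :: real assume "u \<in> {0..1}"
    then show "(\<lambda>\<omega>. B (1/2 + u/2) \<omega> - B (1/2) \<omega>) \<in> borel_measurable (increments_over S)"
      using assms by (intro measurable_increment) auto
  next
    fix \<omega> assume "\<omega> \<in> space (increments_over S)"
    then show "continuous_on {0..1} (\<lambda>u. B (1/2 + u/2) \<omega> - B (1/2) \<omega>)"
      by (intro continuous_intros continuous_on_compose2[OF continuous_paths]) auto
  qed
  show ?thesis unfolding late_argmin_def by measurable
qed

text \<open>Up to the increment over \<open>{1/5..3/10}\<close>, the rotated value is a function of the increments outside that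
interval, and it is a function of the increments outside \<open>{2/5..1/2}\<close>: the argmin depends only on the
increments after \<open>1/2\<close>, and the path is evaluated at it and at a time between \<open>3/10\<close> and \<open>2/5\<close>.\<close>

lemma measurable_rotated_value:
  shows "(\<lambda>\<omega>. rotated_value (\<lambda>t. B t \<omega>)) \<in> borel_measurable (increments_over ({0..2/5} \<union> {1/2..1}))"
    (is "_ \<in> borel_measurable ?F")
    and "(\<lambda>\<omega>. rotated_value (\<lambda>t. B t \<omega>) - (B (3/10) \<omega> - B (1/5) \<omega>))
      \<in> borel_measurable (increments_over ({0..1/5} \<union> {3/10..1}))" (is "_ \<in> borel_measurable ?G")
proof -
  define T where "T \<omega> = late_argmin (\<lambda>t. B t \<omega>)" for \<omega>
  have range: "3/4 \<le> T \<omega>" "T \<omega> \<le> 17/20" for \<omega> unfolding T_def by (rule late_argmin_range)+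
  have T: "T \<in> borel_measurable (increments_over S)" if "{1/2..1} \<subseteq> S" for S
    unfolding T_def using measurable_late_argmin[OF that] .
  have r: "T \<omega> \<in> {1/2..1}" "T \<omega> - 9/20 \<in> {0..2/5}" "T \<omega> - 9/20 \<in> {3/10..2/5}" for \<omega>
    using range[of \<omega>] by auto
  have [measurable]: "T \<in> borel_measurable ?F" "T \<in> borel_measurable ?G" by (rule T; auto)+
  have end_part: "(\<lambda>\<omega>. B (T \<omega>) \<omega> - B (1/2) \<omega>) \<in> borel_measurable (increments_over S)"
    "(\<lambda>\<omega>. B 1 \<omega> - B (1/2) \<omega>) \<in> borel_measurable (increments_over S)" if "{1/2..1} \<subseteq> S" for S
    using that by (intro measurable_increment_at_random_time[of "1/2" 1] measurable_increment T r; simp)+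
  have [measurable]: "(\<lambda>\<omega>. B (T \<omega>) \<omega> - B (1/2) \<omega>) \<in> borel_measurable ?F" "(\<lambda>\<omega>. B (T \<omega>) \<omega> - B (1/2) \<omega>) \<in> borel_measurable ?G"
    "(\<lambda>\<omega>. B 1 \<omega> - B (1/2) \<omega>) \<in> borel_measurable ?F" "(\<lambda>\<omega>. B 1 \<omega> - B (1/2) \<omega>) \<in> borel_measurable ?G"
    by (rule end_part; auto)+
  have [measurable]: "(\<lambda>\<omega>. B (T \<omega> - 9/20) \<omega> - B 0 \<omega>) \<in> borel_measurable ?F"
    by (rule measurable_increment_at_random_time[OF _ _ _ _ _ r(2)]) (auto intro!: borel_measurable_diff T)
  have [measurable]: "(\<lambda>\<omega>. B (T \<omega> - 9/20) \<omega> - B (3/10) \<omega>) \<in> borel_measurable ?G"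
    by (rule measurable_increment_at_random_time[OF _ _ _ _ _ r(3)]) (auto intro!: borel_measurable_diff T)
  have [measurable]: "B (1/5) \<in> borel_measurable ?G" by (rule measurable_B) auto
  have "(\<lambda>\<omega>. (B (T \<omega> - 9/20) \<omega> - B 0 \<omega>) + ((B 1 \<omega> - B (1/2) \<omega>) - (B (T \<omega>) \<omega> - B (1/2) \<omega>))) \<in> borel_measurable ?F"
    by measurable
  then show "(\<lambda>\<omega>. rotated_value (\<lambda>t. B t \<omega>)) \<in> borel_measurable ?F"
    by (rule measurable_cong[THEN iffD1, rotated]) (simp add: rotated_value_def T_def start_zero)
  have "(\<lambda>\<omega>. B (1/5) \<omega> + (B (T \<omega> - 9/20) \<omega> - B (3/10) \<omega>) + ((B 1 \<omega> - B (1/2) \<omega>) - (B (T \<omega>) \<omega> - B (1/2) \<omega>))) \<in> borel_measurable ?G"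
    by measurable
  then show "(\<lambda>\<omega>. rotated_value (\<lambda>t. B t \<omega>) - (B (3/10) \<omega> - B (1/5) \<omega>)) \<in> borel_measurable ?G"
    by (rule measurable_cong[THEN iffD1, rotated]) (simp add: rotated_value_def T_def)
qed

section \<open>Paths with a dip and paths with a positive end\<close>

definition dip_event :: "'a set" where
  "dip_event = {\<omega> \<in> space M. (\<forall>t\<in>{1/10..1/5}. B t \<omega> \<le> - 5) \<and> valley (\<lambda>t. B t \<omega>)}"

definition bounded_event :: "real \<Rightarrow> 'a set" where
  "bounded_event L = {\<omega> \<in> space M. \<forall>t\<in>{0..2/5}. \<bar>B t \<omega>\<bar> \<le> L}"

text \<open>A path bounded by \<open>L\<close> that drops by \<open>2 * L\<close> ends below its earlier values up to \<open>1/4\<close>; this moves the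
global minimum into the valley.\<close>

definition drop_event :: "real \<Rightarrow> 'a set" where
  "drop_event L = {\<omega> \<in> space M. \<forall>t\<in>{2/5..1/2}. \<bar>B t \<omega> - B (2/5) \<omega> - (- 20 * L * (t - 2/5))\<bar> \<le> 1/4}"

lemma sets_dip_event:
  assumes S: "{0..1/5} \<union> {1/2..1} \<subseteq> S"
  shows "dip_event \<in> sets (increments_over S)"
proof -
  let ?N = "increments_over S"
  have "{\<omega> \<in> space ?N. \<forall>t\<in>{1/10..1/5}. B t \<omega> \<le> - 5} \<in> sets ?N"
    using S by (intro sets_path_le) (auto intro!: measurable_B continuous_B)
  moreover have "{\<omega> \<in> space ?N. \<forall>t\<in>{1/2..1}. \<bar>B t \<omega> - B (1/2) \<omega> - well t\<bar> \<le> 1/4} \<in> sets ?N"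
    using S by (intro sets_path_le borel_measurable_abs borel_measurable_diff[OF measurable_increment] borel_measurable_const)
      (auto intro!: continuous_intros continuous_B)
  moreover have "dip_event = {\<omega> \<in> space ?N. \<forall>t\<in>{1/10..1/5}. B t \<omega> \<le> - 5} \<inter>
      {\<omega> \<in> space ?N. \<forall>t\<in>{1/2..1}. \<bar>B t \<omega> - B (1/2) \<omega> - well t\<bar> \<le> 1/4}"
    by (auto simp: dip_event_def valley_def)
  ultimately show ?thesis by (simp only: sets.Int)
qed

lemma sets_bounded_event: "bounded_event L \<in> sets (increments_over ({0..2/5} \<union> {1/2..1}))" (is "_ \<in> sets ?N")
proof -
  have "{\<omega> \<in> space ?N. \<forall>t\<in>{0..2/5}. \<bar>B t \<omega>\<bar> \<le> L} \<in> sets ?N"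
    by (intro sets_path_le borel_measurable_abs) (auto intro!: measurable_B continuous_intros continuous_B)
  then show ?thesis by (simp add: bounded_event_def)
qed

lemma sets_drop_event: "drop_event L \<in> sets (increments_over {2/5..1/2})" (is "_ \<in> sets ?N")
proof -
  have "{\<omega> \<in> space ?N. \<forall>t\<in>{2/5..1/2}. \<bar>B t \<omega> - B (2/5) \<omega> - (- 20 * L * (t - 2/5))\<bar> \<le> 1/4} \<in> sets ?N"
    by (intro sets_path_le borel_measurable_abs borel_measurable_diff[OF measurable_increment] borel_measurable_const)
      (auto intro!: continuous_intros continuous_B)
  then show ?thesis by (simp add: drop_event_def)
qed

lemma prob_dip_event_pos: "0 < prob dip_event"
proof (rule support_theorem_subset[where K = 80 and e = "1/8" and
      \<phi> = "\<lambda>t. max (- 60 * t) (- 6) + min 0 (well t)"])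
  show "dip_event \<in> events"
    using sets_dip_event[of UNIV] increments_over_subset by auto
  fix \<omega> assume w: "\<omega> \<in> space M" and
    tube: "\<And>t. t \<in> {0..1} \<Longrightarrow> \<bar>B t \<omega> - (max (- 60 * t) (- 6) + min 0 (well t))\<bar> \<le> 1/8"
  have "B t \<omega> \<le> - 5" if t: "t \<in> {1/10..1/5}" for t
  proof -
    have "max (- 60 * t) (- 6) + min 0 (well t) = - 6" using t well_nonneg[of t] by auto
    moreover have a: "\<bar>B t \<omega> - (max (- 60 * t) (- 6) + min 0 (well t))\<bar> \<le> 1/8"
      using t by (intro tube) auto
    ultimately show ?thesis using abs_le_D1[OF a] by linarith
  qed
  moreover have "valley (\<lambda>t. B t \<omega>)"
  proof (rule valleyI)
    fix t :: real assume "t \<in> {1/2..1}"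
    then have "max (- 60 * t) (- 6) = - 6" "t \<in> {0..1}" by auto
    with tube[of t] show "\<bar>B t \<omega> - (- 6 + min 0 (well t))\<bar> \<le> 1/8" by (simp only:)
  qed
  ultimately show "\<omega> \<in> dip_event" using w by (auto simp: dip_event_def)
next
  fix s t :: real
  have "\<bar>max (- 60 * s) (- 6) - max (- 60 * t) (- 6)\<bar> \<le> 60 * \<bar>s - t\<bar>"
    by (auto simp: max_def abs_if)
  from lipschitz_add_well[of "\<lambda>t. max (- 60 * t) (- 6)", OF this]
  show "\<bar>(max (- 60 * s) (- 6) + min 0 (well s)) - (max (- 60 * t) (- 6) + min 0 (well t))\<bar> \<le> 80 * \<bar>s - t\<bar>"
    by simp
qed (use well_nonneg[of 0] in auto)

lemma prob_drop_event_pos: "0 \<le> L \<Longrightarrow> 0 < prob (drop_event L)"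
proof (rule support_theorem_subset[where K = "20 * L" and e = "1/8" and \<phi> = "\<lambda>t. - 20 * L * max 0 (t - 2/5)"])
  assume L: "0 \<le> L"
  show "drop_event L \<in> events"
    using sets_drop_event increments_over_subset by auto
  show "\<bar>- 20 * L * max 0 (s - 2/5) - - 20 * L * max 0 (t - 2/5)\<bar> \<le> 20 * L * \<bar>s - t\<bar>" for s t
  proof -
    have "\<bar>- 20 * L * max 0 (s - 2/5) - - 20 * L * max 0 (t - 2/5)\<bar> = 20 * L * \<bar>max 0 (t - 2/5) - max 0 (s - 2/5)\<bar>"
    proof -
      have "- 20 * L * max 0 (s - 2/5) - - 20 * L * max 0 (t - 2/5) = 20 * L * (max 0 (t - 2/5) - max 0 (s - 2/5))"
        by (simp add: algebra_simps)
      then show ?thesis using L by (simp add: abs_mult)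
    qed
    also have "\<dots> \<le> 20 * L * \<bar>s - t\<bar>"
      using L by (intro mult_left_mono) (auto simp: max_def)
    finally show ?thesis .
  qed
  fix \<omega> assume w: "\<omega> \<in> space M" and
    tube: "\<And>t. t \<in> {0..1} \<Longrightarrow> \<bar>B t \<omega> - - 20 * L * max 0 (t - 2/5)\<bar> \<le> 1/8"
  have "\<bar>B t \<omega> - B (2/5) \<omega> - (- 20 * L * (t - 2/5))\<bar> \<le> 1/4" if "t \<in> {2/5..1/2}" for t
  proof -
    have "max 0 (t - 2/5) = t - 2/5" using that by auto
    then have "\<bar>B t \<omega> - - 20 * L * (t - 2/5)\<bar> \<le> 1/8" using tube[of t] that by simp
    moreover have "\<bar>B (2/5) \<omega>\<bar> \<le> 1/8" using tube[of "2/5"] by simp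
    ultimately show ?thesis by (simp only: abs_le_iff) linarith
  qed
  then show "\<omega> \<in> drop_event L" using w by (auto simp: drop_event_def)
qed auto

lemma vervaat_dip:
  assumes w: "\<omega> \<in> dip_event" "\<omega> \<in> bounded_event L" "\<omega> \<in> drop_event L" and "0 \<le> L"
  shows "vervaat (\<lambda>t. B t \<omega>) (7/20) < 0"
    "vervaat (\<lambda>t. B t \<omega>) (11/20) = rotated_value (\<lambda>t. B t \<omega>)"
proof -
  have v: "valley (\<lambda>t. B t \<omega>)" and low: "\<And>t. t \<in> {1/10..1/5} \<Longrightarrow> B t \<omega> \<le> - 5"
    and \<omega>: "\<omega> \<in> space M" using w(1) by (auto simp: dip_event_def)
  have drop: "\<bar>B t \<omega> - B (2/5) \<omega> - (- 20 * L * (t - 2/5))\<bar> \<le> 1/4" if "t \<in> {2/5..1/2}" for t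
    using w(3) that by (auto simp: drop_event_def)
  have bd: "\<bar>B t \<omega>\<bar> \<le> L" if "t \<in> {0..2/5}" for t using w(2) that by (auto simp: bounded_event_def)
  have half: "B (1/2) \<omega> \<le> B (2/5) \<omega> - 2 * L + 1/4" using drop[of "1/2"] unfolding abs_le_iff by simp
  have early: "B (1/2) \<omega> - 11/2 \<le> B t \<omega>" if t: "t \<in> {0..1/2}" for t
  proof (cases "t \<le> 2/5")
    case True
    then have "\<bar>B t \<omega>\<bar> \<le> L" "\<bar>B (2/5) \<omega>\<bar> \<le> L" using t by (auto intro: bd)
    then show ?thesis using half unfolding abs_le_iff by linarith
  next
    case False
    have "20 * L * (t - 2/5) \<le> 20 * L * (1/10)" using t \<open>0 \<le> L\<close> by (intro mult_left_mono) auto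
    moreover have "\<bar>B t \<omega> - B (2/5) \<omega> - (- 20 * L * (t - 2/5))\<bar> \<le> 1/4" using t False by (intro drop) auto
    ultimately show ?thesis using half unfolding abs_le_iff by linarith
  qed
  show "vervaat (\<lambda>t. B t \<omega>) (7/20) < 0"
    by (rule vervaat_valley_neg[OF continuous_paths[OF \<omega>] v early low])
  show "vervaat (\<lambda>t. B t \<omega>) (11/20) = rotated_value (\<lambda>t. B t \<omega>)"
    by (rule vervaat_valley[OF continuous_paths[OF \<omega>] v early])
qed

text \<open>The hypothesis controls the rotated value only if the path also drops far enough. The drop is
independent of everything else in the statement and has positive probability, so it can be removed
from the event for each bound \<open>L\<close>, and the bounds exhaust all paths.\<close>

lemma dip_event_values_null:
  assumes C[measurable]: "C \<in> sets borel"
    and ae: "AE \<omega> in M. vervaat (\<lambda>t. B t \<omega>) (7/20) < 0 \<longrightarrow> vervaat (\<lambda>t. B t \<omega>) (11/20) \<notin> C"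
  shows "AE \<omega> in M. \<omega> \<in> dip_event \<longrightarrow> rotated_value (\<lambda>t. B t \<omega>) \<notin> C"
proof -
  let ?N = "increments_over ({0..2/5} \<union> {1/2..1})"
  have "AE \<omega> in M. \<omega> \<in> dip_event \<inter> bounded_event (real n) \<longrightarrow> rotated_value (\<lambda>t. B t \<omega>) \<notin> C" for n :: nat
  proof -
    define D where "D = dip_event \<inter> bounded_event (real n) \<inter> ((\<lambda>\<omega>. rotated_value (\<lambda>t. B t \<omega>)) -` C \<inter> space ?N)"
    have D: "D \<in> sets ?N"
      unfolding D_def
      by (intro sets.Int sets_dip_event sets_bounded_event measurable_sets[OF measurable_rotated_value(1) C]) auto
    have ev: "D \<in> events" "drop_event (real n) \<in> events"
      using D sets_drop_event increments_over_subset by blast+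
    have "AE \<omega> in M. \<omega> \<notin> D \<inter> drop_event (real n)"
      using ae by eventually_elim (auto simp: D_def dest: vervaat_dip)
    then have "prob (D \<inter> drop_event (real n)) = 0"
      using ev by (subst prob_eq_0) auto
    moreover have "prob (D \<inter> drop_event (real n)) = prob D * prob (drop_event (real n))"
    proof (rule prob_indep_increments_over[OF _ D sets_drop_event])
      show "finite (({0..2/5} \<union> {1/2..1}) \<inter> {2/5..1/2 :: real})"
        by (rule finite_subset[of _ "{2/5, 1/2}"]) auto
    qed
    ultimately have "prob D = 0" using prob_drop_event_pos[of "real n"] by simp
    then have "AE \<omega> in M. \<omega> \<notin> D" using ev by (subst (asm) prob_eq_0) auto
    then show ?thesis using AE_space by eventually_elim (auto simp: D_def)
  qed
  then have "AE \<omega> in M. \<forall>n::nat. \<omega> \<in> dip_event \<inter> bounded_event (real n) \<longrightarrow> rotated_value (\<lambda>t. B t \<omega>) \<notin> C"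
    unfolding AE_all_countable by blast
  then show ?thesis using AE_space
  proof eventually_elim
    fix \<omega> assume w: "\<omega> \<in> space M" and
      all: "\<forall>n::nat. \<omega> \<in> dip_event \<inter> bounded_event (real n) \<longrightarrow> rotated_value (\<lambda>t. B t \<omega>) \<notin> C"
    have "compact ((\<lambda>t. B t \<omega>) ` {0..2/5})"
      using continuous_B[OF w] by (intro compact_continuous_image) auto
    then obtain K where K: "\<And>t. t \<in> {0..2/5} \<Longrightarrow> \<bar>B t \<omega>\<bar> \<le> K"
      using compact_imp_bounded by (fastforce simp: bounded_iff)
    obtain n :: nat where "K \<le> real n" using real_arch_simple by blast
    then have "\<omega> \<in> bounded_event (real n)" using K w by (force simp: bounded_event_def)
    with all show "\<omega> \<in> dip_event \<longrightarrow> rotated_value (\<lambda>t. B t \<omega>) \<notin> C" by blast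
  qed
qed

text \<open>On the dip event the increment over \<open>{1/5..3/10}\<close> is free, so the avoided set is Lebesgue null; a null
set is then avoided on the whole space.\<close>

lemma AE_rotated_value_notin:
  assumes C[measurable]: "C \<in> sets borel"
    and ae: "AE \<omega> in M. \<omega> \<in> dip_event \<longrightarrow> rotated_value (\<lambda>t. B t \<omega>) \<notin> C"
  shows "AE \<omega> in M. rotated_value (\<lambda>t. B t \<omega>) \<notin> C"
proof -
  let ?F = "increments_over ({0..1/5} \<union> {3/10..1})" and ?G = "increments_over {1/5..3/10}"
  define b Z where "b \<omega> = B (3/10) \<omega> - B (1/5) \<omega>" and "Z \<omega> = rotated_value (\<lambda>t. B t \<omega>) - b \<omega>" for \<omega>
  have b: "distributed M lborel b (normal_density 0 (sqrt (3/10 - 1/5)))"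
    unfolding b_def by (rule normal_increments) auto
  have "finite (({0..1/5} \<union> {3/10..1}) \<inter> {1/5..3/10 :: real})"
    by (rule finite_subset[of _ "{1/5, 3/10}"]) auto
  then have indep: "indep_set (sets ?F) (sets ?G)" by (rule indep_increments_over)
  have bG: "b \<in> borel_measurable ?G" unfolding b_def by (rule measurable_increment) auto
  have Z: "Z \<in> borel_measurable ?F" unfolding Z_def b_def by (rule measurable_rotated_value(2))
  have eq: "b \<omega> + Z \<omega> = rotated_value (\<lambda>t. B t \<omega>)" for \<omega> by (simp add: Z_def)
  have "AE x in lborel. x \<notin> C"
    using ae prob_dip_event_pos
    by (intro indep_normal_sum_notin_imp_null[OF b _ C indep _ _ bG Z, of dip_event]) (auto simp: eq intro: sets_dip_event)
  then have "AE \<omega> in M. b \<omega> + Z \<omega> \<notin> C"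
    by (intro indep_normal_sum_notin_null[OF b _ C indep _ _ bG Z]) auto
  then show ?thesis by (simp add: eq)
qed

text \<open>The center of the tube rises to \<open>3\<close>, so that after the fall by \<open>6\<close> and the climb by \<open>4\<close> it ends at \<open>1\<close>.\<close>

definition rise_event :: "'a set" where
  "rise_event = {\<omega> \<in> space M. \<forall>t\<in>{0..1}. \<bar>B t \<omega> - (min (6 * t) 3 + min 0 (well t))\<bar> \<le> 1/8}"

lemma prob_rise_event_pos: "0 < prob rise_event"
  unfolding rise_event_def
proof (rule support_theorem[where K = 26])
  fix s t :: real
  have "\<bar>min (6 * s) 3 - min (6 * t) 3\<bar> \<le> 6 * \<bar>s - t\<bar>"
    by (auto simp: min_def abs_if)
  from lipschitz_add_well[of "\<lambda>t. min (6 * t) 3", OF this]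
  show "\<bar>(min (6 * s) 3 + min 0 (well s)) - (min (6 * t) 3 + min 0 (well t))\<bar> \<le> 26 * \<bar>s - t\<bar>"
    by simp
qed (use well_nonneg[of 0] in auto)

lemma vervaat_rise:
  assumes "\<omega> \<in> rise_event"
  shows "0 < vervaat (\<lambda>t. B t \<omega>) 1"
    "vervaat (\<lambda>t. B t \<omega>) (11/20) = rotated_value (\<lambda>t. B t \<omega>)"
proof -
  have \<omega>: "\<omega> \<in> space M"
    and tube: "\<And>t. t \<in> {0..1} \<Longrightarrow> \<bar>B t \<omega> - (min (6 * t) 3 + min 0 (well t))\<bar> \<le> 1/8"
    using assms by (auto simp: rise_event_def)
  have v: "valley (\<lambda>t. B t \<omega>)"
  proof (rule valleyI)
    fix t :: real assume "t \<in> {1/2..1}"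
    then have "min (6 * t) 3 = 3" "t \<in> {0..1}" by auto
    with tube[of t] show "\<bar>B t \<omega> - (3 + min 0 (well t))\<bar> \<le> 1/8" by (simp only:)
  qed
  have early: "B (1/2) \<omega> - 11/2 \<le> B t \<omega>" if "t \<in> {0..1/2}" for t
  proof -
    have "well t \<ge> 0" "min (6 * t) 3 \<ge> 0" using well_nonneg[OF that] that by auto
    then have "min (6 * t) 3 + min 0 (well t) \<ge> 0" by simp
    moreover have a: "\<bar>B t \<omega> - (min (6 * t) 3 + min 0 (well t))\<bar> \<le> 1/8"
      using that by (intro tube) auto
    moreover have b: "\<bar>B (1/2) \<omega> - 3\<bar> \<le> 1/8" using tube[of "1/2"] by simp
    ultimately show ?thesis using abs_le_D2[OF a] abs_le_D1[OF b] by linarith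
  qed
  have end1: "\<bar>B 1 \<omega> - 1\<bar> \<le> 1/8" using tube[of 1] by simp
  have "0 < B 1 \<omega>" using abs_le_D2[OF end1] by linarith
  then show "0 < vervaat (\<lambda>t. B t \<omega>) 1"
    using vervaat_valley_end[OF continuous_paths[OF \<omega>] v early] by simp
  show "vervaat (\<lambda>t. B t \<omega>) (11/20) = rotated_value (\<lambda>t. B t \<omega>)"
    by (rule vervaat_valley[OF continuous_paths[OF \<omega>] v early])
qed

end

section \<open>The Vervaat transform is not Markov\<close>

theorem proposition4p1:
  fixes M :: "'a measure" and B :: "real \<Rightarrow> 'a \<Rightarrow> real"
  assumes "standard_brownian_motion M B"
  shows "\<not> markov_process M {0..1} (\<lambda>t \<omega>. vervaat (\<lambda>s. B s \<omega>) t)"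
proof
  interpret standard_brownian_motion M B by fact
  define V where "V t \<omega> = vervaat (\<lambda>s. B s \<omega>) t" for t \<omega>
  assume "markov_process M {0..1} (\<lambda>t \<omega>. vervaat (\<lambda>s. B s \<omega>) t)"
  then have markov: "markov_process M {0..1} V" by (simp add: V_def[abs_def])
  have disj: "AE \<omega> in M. \<not> (V (7/20) \<omega> \<in> {..<0} \<and> V 1 \<omega> \<in> {0<..})"
    using AE_space
  proof eventually_elim
    fix \<omega> assume "\<omega> \<in> space M"
    then show "\<not> (V (7/20) \<omega> \<in> {..<0} \<and> V 1 \<omega> \<in> {0<..})"
      using vervaat_end_le_0[OF continuous_paths start_zero, of \<omega> "7/20"] by (auto simp: V_def)
  qed
  obtain N where N[measurable]: "N \<in> sets borel"
    and past: "AE \<omega> in M. V (7/20) \<omega> \<in> {..<0} \<longrightarrow> V (11/20) \<omega> \<in> N"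
    and future: "AE \<omega> in M. V 1 \<omega> \<in> {0<..} \<longrightarrow> V (11/20) \<omega> \<notin> N"
    by (rule markov_process_separation[OF prob_space_axioms markov _ _ _ _ _ _ _ disj, of "11/20"];
        (assumption | simp))
  have "AE \<omega> in M. \<omega> \<in> dip_event \<longrightarrow> rotated_value (\<lambda>t. B t \<omega>) \<notin> - N"
    using past by (intro dip_event_values_null) (auto simp: V_def)
  then have "AE \<omega> in M. rotated_value (\<lambda>t. B t \<omega>) \<notin> - N"
    by (intro AE_rotated_value_notin) auto
  with future have "AE \<omega> in M. \<omega> \<notin> rise_event"
    by eventually_elim (use vervaat_rise in \<open>auto simp: V_def\<close>)
  moreover have "rise_event \<in> events"
    using prob_rise_event_pos measure_notin_sets by fastforce
  ultimately have "prob rise_event = 0" by (simp add: prob_eq_0)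
  with prob_rise_event_pos show False by simp
qed

end
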